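(* There exists an algorithm which, given an instance of \textsc{DPVC} and a tree decomposition of width $t$ of the input graph, computes an optimal solution in time $(M+1)^{t+1}n^{O(1)}$, where $M$ is the maximum edge weight and $n$ is the number of vertices. Similarly, there exists an algorithm that, on the same input, computes an optimal solution in time $(\Delta+1)^{t+1}n^{O(1)}$, where $\Delta$ is the maximum degree of the graph.
   Context: \textsc{Directed Power Vertex Cover (DPVC)}: the input is a finite simple undirected graph $G=(V,E)$ together with, for each edge $(u,v)\in E$, two positive integers $w_{u,v}$ and $w_{v,u}$. A feasible solution assigns to each $v\in V$ a value $p_v\ge 0$ such that for every edge $(u,v)\in E$ we have $p_u\ge w_{u,v}$ or $p_v\ge w_{v,u}$. The goal is to minimize $\sum_{v\in V}p_v$. The maximum edge weight is $M=\max_{(u,v)\in E}\max\{w_{u,v},w_{v,u}\}$. Convention: as is standard, the supplied tree decomposition may be assumed to be a nice tree decomposition (rooted binary, with leaf, introduce, forget and join nodes). *)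

theory Defs
  imports Complex_Main "Graph_Theory.Graph_Theory"
begin

section \<open>Directed Power Vertex Cover\<close>

text \<open>
  A finite simple undirected graph is a \<^locale>\<open>pair_graph\<close>, in which an undirected
  edge \<open>uv\<close> is the pair of opposite arcs \<open>(u, v)\<close> and \<open>(v, u)\<close>. Only the values of
  \<open>w\<close> on arcs matter.
\<close>

locale dpvc = pair_graph G for G :: "nat pair_pre_digraph" +
  fixes w :: "nat \<Rightarrow> nat \<Rightarrow> nat"
  assumes weight_pos: "(u, v) \<in> parcs G \<Longrightarrow> 0 < w u v"

definition feasible ::
    "nat pair_pre_digraph \<Rightarrow> (nat \<Rightarrow> nat \<Rightarrow> nat) \<Rightarrow> (nat \<Rightarrow> real) \<Rightarrow> bool" where
  "feasible G w p \<longleftrightarrow>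
     (\<forall>v\<in>pverts G. 0 \<le> p v) \<and>
     (\<forall>(u, v)\<in>parcs G. real (w u v) \<le> p u \<or> real (w v u) \<le> p v)"

definition optimal ::
    "nat pair_pre_digraph \<Rightarrow> (nat \<Rightarrow> nat \<Rightarrow> nat) \<Rightarrow> (nat \<Rightarrow> real) \<Rightarrow> bool" where
  "optimal G w p \<longleftrightarrow>
     feasible G w p \<and>
     (\<forall>q. feasible G w q \<longrightarrow> (\<Sum>v\<in>pverts G. p v) \<le> (\<Sum>v\<in>pverts G. q v))"

text \<open>The inserted \<open>0\<close> only matters for graphs without edges (vertices, respectively).\<close>

definition max_weight :: "nat pair_pre_digraph \<Rightarrow> (nat \<Rightarrow> nat \<Rightarrow> nat) \<Rightarrow> nat" where
  "max_weight G w = Max (insert 0 ((\<lambda>(u, v). max (w u v) (w v u)) ` parcs G))"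

definition max_degree :: "nat pair_pre_digraph \<Rightarrow> nat" where
  "max_degree G = Max (insert 0 (out_degree G ` pverts G))"

section \<open>Tree decompositions\<close>

text \<open>
  The tree of a decomposition is given as a rooted ordered tree of bags. Its nodes are
  addressed by paths from the root: \<open>i # p\<close> is the node \<open>p\<close> of the \<open>i\<close>-th subtree.
\<close>

datatype decomp = Bag "nat set" "decomp list"

lemma size_nth_less [termination_simp]:
  "i < length ts \<Longrightarrow> size (ts ! i) < Suc (size_list size ts)"
  using size_list_estimation'[OF nth_mem order_refl, of i ts size] by simp

fun nodes :: "decomp \<Rightarrow> nat list set" where
  "nodes (Bag X ts) = insert [] (\<Union>i<length ts. (#) i ` nodes (ts ! i))"

fun bag :: "decomp \<Rightarrow> nat list \<Rightarrow> nat set" where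
  "bag (Bag X ts) [] = X"
| "bag (Bag X ts) (i # p) = bag (ts ! i) p"

definition decomp_tree :: "decomp \<Rightarrow> nat list pair_pre_digraph" where
  "decomp_tree T =
     \<lparr>pverts = nodes T, parcs = {(p, p @ [i]) | p i. p @ [i] \<in> nodes T}\<rparr>"

text \<open>
  \<^const>\<open>connected\<close> ignores the direction of arcs and requires a vertex to be present, so
  the last condition also says that every vertex of \<open>G\<close> lies in some bag.
\<close>

definition tree_decomposition :: "nat pair_pre_digraph \<Rightarrow> decomp \<Rightarrow> bool" where
  "tree_decomposition G T \<longleftrightarrow>
     (\<forall>x\<in>nodes T. bag T x \<subseteq> pverts G) \<and>
     (\<forall>(u, v)\<in>parcs G. \<exists>x\<in>nodes T. u \<in> bag T x \<and> v \<in> bag T x) \<and>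
     (\<forall>v\<in>pverts G. connected (decomp_tree T \<restriction> {x \<in> nodes T. v \<in> bag T x}))"

text \<open>The subtraction truncates only if all bags are empty, i.e. for the empty graph.\<close>

definition width :: "decomp \<Rightarrow> nat" where
  "width T = Max ((\<lambda>x. card (bag T x)) ` nodes T) - 1"

section \<open>Algorithms and their running time\<close>

text \<open>
  Algorithms are programs in a first-order language with recursive functions over binary
  trees with natural numbers at the leaves. Each evaluation step costs one unit.

  This is a reasonable unit-cost model: values are immutable and can be shared, and
  variable indices and argument counts are bounded by constants of the program, so each step
  takes constant time on a random access machine with unit-cost addition and
  subtraction. There is no multiplication, so that in \<open>s\<close> steps the numbers of the input and
  the program grow by at most \<open>s\<close> bits, and there is no comparison of compound values.
\<close>

datatype val = Num nat | Cell val val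

datatype exp =
    Var nat                 \<comment> \<open>index into the environment\<close>
  | Lit nat
  | MkCell exp exp
  | Fst exp
  | Snd exp
  | IsNum exp
  | Add exp exp
  | Monus exp exp
  | IfZero exp exp exp
  | Bind exp exp            \<comment> \<open>the bound value becomes variable 0 in the second expression\<close>
  | Call nat "exp list"     \<comment> \<open>the body sees exactly the argument values\<close>

text \<open>A program is the list of the bodies of its functions.\<close>

type_synonym prog = "exp list"

text \<open>
  \<open>eval P env e v s\<close>: in environment \<open>env\<close>, expression \<open>e\<close> evaluates to \<open>v\<close> in exactly \<open>s\<close> steps.
  There is no derivation for a diverging or ill-typed expression.
\<close>

inductive
  eval :: "prog \<Rightarrow> val list \<Rightarrow> exp \<Rightarrow> val \<Rightarrow> nat \<Rightarrow> bool" and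
  evals :: "prog \<Rightarrow> val list \<Rightarrow> exp list \<Rightarrow> val list \<Rightarrow> nat \<Rightarrow> bool"
  for P :: prog
where
  eval_Var: "i < length env \<Longrightarrow> eval P env (Var i) (env ! i) 1"
| eval_Lit: "eval P env (Lit n) (Num n) 1"
| eval_MkCell: "eval P env a x s \<Longrightarrow> eval P env b y t \<Longrightarrow>
    eval P env (MkCell a b) (Cell x y) (s + t + 1)"
| eval_Fst: "eval P env a (Cell x y) s \<Longrightarrow> eval P env (Fst a) x (s + 1)"
| eval_Snd: "eval P env a (Cell x y) s \<Longrightarrow> eval P env (Snd a) y (s + 1)"
| eval_IsNum_Num: "eval P env a (Num n) s \<Longrightarrow> eval P env (IsNum a) (Num 1) (s + 1)"
| eval_IsNum_Cell: "eval P env a (Cell x y) s \<Longrightarrow> eval P env (IsNum a) (Num 0) (s + 1)"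
| eval_Add: "eval P env a (Num m) s \<Longrightarrow> eval P env b (Num n) t \<Longrightarrow>
    eval P env (Add a b) (Num (m + n)) (s + t + 1)"
| eval_Monus: "eval P env a (Num m) s \<Longrightarrow> eval P env b (Num n) t \<Longrightarrow>
    eval P env (Monus a b) (Num (m - n)) (s + t + 1)"
| eval_IfZero_0: "eval P env c (Num 0) s \<Longrightarrow> eval P env a x t \<Longrightarrow>
    eval P env (IfZero c a b) x (s + t + 1)"
| eval_IfZero_Suc: "eval P env c (Num (Suc n)) s \<Longrightarrow> eval P env b x t \<Longrightarrow>
    eval P env (IfZero c a b) x (s + t + 1)"
| eval_Bind: "eval P env a x s \<Longrightarrow> eval P (x # env) b y t \<Longrightarrow>
    eval P env (Bind a b) y (s + t + 1)"
| eval_Call: "f < length P \<Longrightarrow> evals P env as xs s \<Longrightarrow> eval P xs (P ! f) y t \<Longrightarrow>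
    eval P env (Call f as) y (s + t + 1)"
| evals_Nil: "evals P env [] [] 0"
| evals_Cons: "eval P env a x s \<Longrightarrow> evals P env as xs t \<Longrightarrow>
    evals P env (a # as) (x # xs) (s + t)"

inductive_simps eval_iff:
  "eval P env (Var i) v s" "eval P env (Lit n) v s" "eval P env (MkCell a b) v s"
  "eval P env (Fst a) v s" "eval P env (Snd a) v s" "eval P env (IsNum a) v s"
  "eval P env (Add a b) v s" "eval P env (Monus a b) v s" "eval P env (IfZero c a b) v s"
  "eval P env (Bind a b) v s" "eval P env (Call f as) v s"
  "evals P env [] vs s" "evals P env (a # as) vs s"

lemma eval_deterministic_aux:
  "eval P env e v s \<Longrightarrow> (\<forall>v' s'. eval P env e v' s' \<longleftrightarrow> v' = v \<and> s' = s)"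
  "evals P env es vs s \<Longrightarrow> (\<forall>vs' s'. evals P env es vs' s' \<longleftrightarrow> vs' = vs \<and> s' = s)"
  by (induction rule: eval_evals.inducts) (auto simp: eval_iff)

lemma eval_deterministic:
  "eval P env e v s \<Longrightarrow> eval P env e v' s' \<Longrightarrow> v' = v \<and> s' = s"
  using eval_deterministic_aux(1) by blast

text \<open>A program is started by running the body of function 0 on the input.\<close>

definition computes :: "prog \<Rightarrow> val \<Rightarrow> val \<Rightarrow> nat \<Rightarrow> bool" where
  "computes P x y s \<longleftrightarrow> P \<noteq> [] \<and> eval P [x] (P ! 0) y s"

section \<open>Algorithms for Directed Power Vertex Cover\<close>

text \<open>
  The graph is passed as the list of its vertices, each with its list of neighbours \<open>v\<close>
  and weights \<^term>\<open>w u v\<close>; a decomposition is passed as the tree of its bags. An algorithm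
  knows neither the width nor the maximum weight or degree in advance.
\<close>

fun enc_list :: "val list \<Rightarrow> val" where
  "enc_list [] = Num 0"
| "enc_list (x # xs) = Cell x (enc_list xs)"

definition enc_set :: "(nat \<Rightarrow> val) \<Rightarrow> nat set \<Rightarrow> val" where
  "enc_set f X = enc_list (map f (sorted_list_of_set X))"

definition enc_graph :: "nat pair_pre_digraph \<Rightarrow> (nat \<Rightarrow> nat \<Rightarrow> nat) \<Rightarrow> val" where
  "enc_graph G w =
     enc_set
       (\<lambda>u. Cell (Num u) (enc_set (\<lambda>v. Cell (Num v) (Num (w u v))) {v. (u, v) \<in> parcs G}))
       (pverts G)"

fun enc_decomp :: "decomp \<Rightarrow> val" where
  "enc_decomp (Bag X ts) = Cell (enc_set Num X) (enc_list (map enc_decomp ts))"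

definition enc_input :: "nat pair_pre_digraph \<Rightarrow> (nat \<Rightarrow> nat \<Rightarrow> nat) \<Rightarrow> decomp \<Rightarrow> val" where
  "enc_input G w T = Cell (enc_graph G w) (enc_decomp T)"

definition enc_solution :: "nat pair_pre_digraph \<Rightarrow> (nat \<Rightarrow> nat) \<Rightarrow> val" where
  "enc_solution G p = enc_set (\<lambda>v. Cell (Num v) (Num (p v))) (pverts G)"

text \<open>
  The computed solution has natural values, but it has to be optimal among all real-valued
  ones.
\<close>

definition solves_dpvc_in_time ::
    "prog \<Rightarrow> (nat pair_pre_digraph \<Rightarrow> (nat \<Rightarrow> nat \<Rightarrow> nat) \<Rightarrow> decomp \<Rightarrow> nat) \<Rightarrow> bool" where
  "solves_dpvc_in_time P f \<longleftrightarrow>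
     (\<forall>G w T. dpvc G w \<and> tree_decomposition G T \<longrightarrow>
        (\<exists>p s. computes P (enc_input G w T) (enc_solution G p) s \<and>
               optimal G w (\<lambda>v. real (p v)) \<and> s \<le> f G w T))"

text \<open>
  A decomposition may have arbitrarily many nodes, all of which the algorithm may have to
  read. A polynomial \<open>n\<^sup>O\<^sup>(\<^sup>1\<^sup>)\<close> in the number of vertices presupposes that there are
  \<open>n\<^sup>O\<^sup>(\<^sup>1\<^sup>)\<close> nodes; a polynomial in the following number makes this explicit and
  is the same for such decompositions.
\<close>

definition instance_size :: "nat pair_pre_digraph \<Rightarrow> decomp \<Rightarrow> nat" where
  "instance_size G T = card (pverts G) + card (nodes T)"

end

theory Submission
  imports Defs "HOL-Library.Sublist"
begin

text \<open>
  In an optimal solution the power of \<open>v\<close> may be taken from \<open>{0} \<union> {w v u | u. uv an edge}\<close>, which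
  has at most \<open>min M \<Delta> + 1\<close> elements. Hence a single program, which never needs to know \<open>M\<close> or
  \<open>\<Delta>\<close>, achieves both bounds.

  The program computes for every node of the tree a table indexed by the assignments of such
  values to the intersection of its bag with the parent bag. An entry is found by branching over
  the values of the remaining vertices of the bag, which occur nowhere above, and combining the
  entries of the children that agree with the assignment. Since any two adjacent vertices share a
  bag, an edge can be checked when the first of its ends is forgotten, or the second one if
  both are forgotten at the same node. A node is thus processed with at most one branching step
  per vertex of its bag, which gives the factor \<open>(min M \<Delta> + 1)^(t + 1)\<close>; no nice
  decomposition is needed.
\<close>

section \<open>The dynamic program\<close>

text \<open>Infeasibility never has to be represented. A candidate for a vertex is raised to the
  least value compatible with the values already chosen; the result is again a candidate, and a
  value taken from a feasible solution is left unchanged, so no optimum is lost. Real solutions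
  cannot do better, because every value may be rounded down to a candidate. The language has neither
  arrays nor comparison of compound values. An entry is therefore found by walking down a trie, one
  level per vertex of the key, which costs polynomial time for each child and branch. Running time
  and correctness are separated: the program is shown to return exactly the encoded value of the
  recursive function \<open>solve\<close>, whose optimality is then proved without reference to
  steps.\<close>

definition look :: "'b \<Rightarrow> ('a \<times> 'b) list \<Rightarrow> 'a \<Rightarrow> 'b" where
  "look d xs k = (case map_of xs k of None \<Rightarrow> d | Some x \<Rightarrow> x)"

lemma look_simps [simp]:
  "look d [] k = d"
  "look d ((k', x) # xs) k = (if k' = k then x else look d xs k)"
  by (auto simp: look_def)

lemma look_map: "look d (map (\<lambda>v. (v, f v)) xs) k = (if k \<in> set xs then f k else d)"
  by (induction xs) auto

type_synonym graph = "(nat \<times> (nat \<times> nat) list) list"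
type_synonym assignment = "(nat \<times> nat) list"
type_synonym table = "nat list \<times> (assignment \<Rightarrow> nat \<times> assignment)"

abbreviation val_of :: "assignment \<Rightarrow> nat \<Rightarrow> nat" where
  "val_of \<equiv> look 0"

definition wt :: "graph \<Rightarrow> nat \<Rightarrow> nat \<Rightarrow> nat" where
  "wt g u v = look 0 (look [] g u) v"

definition cands :: "graph \<Rightarrow> nat \<Rightarrow> nat list" where
  "cands g v = fold (\<lambda>(u, x). List.insert x) (look [] g v) [0]"

text \<open>
  Raising every candidate to this bound keeps all assignments feasible, so that no value for
  infeasibility is needed.
\<close>

fun lower :: "graph \<Rightarrow> nat \<Rightarrow> assignment \<Rightarrow> nat" where
  "lower g v [] = 0"
| "lower g v ((u, b) # f) =
     (if wt g u v \<le> b then lower g v f else max (wt g v u) (lower g v f))"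

text \<open>
  A table \<open>(A, F)\<close> is indexed by the assignments \<open>f\<close> to the vertices \<open>A\<close>, listed in reverse order;
  \<open>F f\<close> is an optimal assignment to the vertices below, together with its cost.
\<close>

fun gather :: "assignment \<Rightarrow> table list \<Rightarrow> nat \<times> assignment" where
  "gather f [] = (0, [])"
| "gather f ((A, F) # tbs) =
     (let r = F (rev (map (\<lambda>v. (v, val_of f v)) A)); q = gather f tbs
      in (fst r + fst q, snd r @ snd q))"

text \<open>Each chosen pair is pushed onto \<open>f\<close>, so later vertices of the list are
  checked against earlier ones as well, and \<open>h\<close> finally receives an assignment to the
  whole bag.\<close>

fun forget ::
    "graph \<Rightarrow> (assignment \<Rightarrow> nat \<times> assignment) \<Rightarrow> nat list \<Rightarrow> assignment \<Rightarrow> nat \<times> assignment"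
where
  "forget g h [] f = h f"
| "forget g h (v # B) f =
     arg_min_list fst
       (map (\<lambda>a. let b = max (lower g v f) a; r = forget g h B ((v, b) # f)
                 in (b + fst r, (v, b) # snd r))
         (cands g v))"

fun solve :: "graph \<Rightarrow> nat list \<Rightarrow> decomp \<Rightarrow> table" where
  "solve g X (Bag Y ts) =
     (let ys = sorted_list_of_set Y
      in (filter (\<lambda>v. v \<in> set X) ys,
          forget g (\<lambda>f. gather f (map (solve g ys) ts)) (filter (\<lambda>v. v \<notin> set X) ys)))"

lemma set_fold_insert:
  "set (fold (\<lambda>(u, x). List.insert x) xs acc) = set acc \<union> snd ` set xs"
  by (induction xs arbitrary: acc) auto

lemma set_cands: "set (cands g v) = insert 0 (snd ` set (look [] g v))"
  by (auto simp: cands_def set_fold_insert)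

text \<open>Repetitions would spoil the bound by the maximum weight, since a vertex may have many
  more neighbours than there are different weights.\<close>

lemma distinct_cands: "distinct (cands g v)"
proof -
  have "distinct (fold (\<lambda>(u, x). List.insert x) xs acc)" if "distinct acc"
    for xs :: "(nat \<times> nat) list" and acc
    using that by (induction xs arbitrary: acc) auto
  then show ?thesis by (simp add: cands_def)
qed

lemma length_cands_le: "length (cands g v) \<le> length (look [] g v) + 1"
proof -
  have "length (cands g v) = card (insert 0 (snd ` set (look [] g v)))"
    by (metis distinct_cands distinct_card set_cands)
  also have "\<dots> \<le> card (snd ` set (look [] g v)) + 1"
    by (simp add: card_insert_le_m1 card_insert_if)
  also have "\<dots> \<le> length (look [] g v) + 1"
    using card_image_le[of "set (look [] g v)" snd] card_length[of "look [] g v"] by simp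
  finally show ?thesis .
qed

lemma cands_not_Nil: "cands g v \<noteq> []"
  using set_cands[of g v] by auto

lemma wt_in_cands: "wt g v u \<in> set (cands g v)"
  unfolding set_cands wt_def by (force simp: look_def[of 0] split: option.split dest: map_of_SomeD)

lemma zero_in_cands: "0 \<in> set (cands g v)"
  by (simp add: set_cands)

text \<open>A maximum of 0 and weights at \<open>v\<close> is one of them. Hence a raised candidate
  is still a candidate and will be found in every trie.\<close>

lemma lower_in_cands: "lower g v f \<in> set (cands g v)"
  by (induction g v f rule: lower.induct) (auto simp: zero_in_cands wt_in_cands max_def)

section \<open>Evaluation as a function\<close>

text \<open>In this functional form the simplifier can execute a body symbolically and add up its
  steps. Evaluation may diverge, so \<open>run\<close> is defined by choice from the deterministic
  relation and not by recursion.\<close>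

definition run :: "prog \<Rightarrow> val list \<Rightarrow> exp \<Rightarrow> (val \<times> nat) option" where
  "run P env e =
     (if \<exists>r. eval P env e (fst r) (snd r) then Some (SOME r. eval P env e (fst r) (snd r)) else None)"

definition run_args :: "prog \<Rightarrow> val list \<Rightarrow> exp list \<Rightarrow> (val list \<times> nat) option" where
  "run_args P env es =
     (if \<exists>r. evals P env es (fst r) (snd r) then Some (SOME r. evals P env es (fst r) (snd r)) else None)"

lemma run_eq_Some_iff: "run P env e = Some (v, s) \<longleftrightarrow> eval P env e v s"
proof
  assume "run P env e = Some (v, s)"
  then have "\<exists>r. eval P env e (fst r) (snd r)" "(SOME r. eval P env e (fst r) (snd r)) = (v, s)"
    unfolding run_def by (auto split: if_splits)
  then show "eval P env e v s"
    by (metis fst_conv snd_conv someI_ex)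
next
  assume *: "eval P env e v s"
  then have "\<exists>r. eval P env e (fst r) (snd r)" by auto
  moreover from someI_ex[OF this] have "(SOME r. eval P env e (fst r) (snd r)) = (v, s)"
    using eval_deterministic[OF *] by (metis prod.collapse)
  ultimately show "run P env e = Some (v, s)" unfolding run_def by presburger
qed

lemma run_args_eq_Some_iff: "run_args P env es = Some (vs, s) \<longleftrightarrow> evals P env es vs s"
proof
  assume "run_args P env es = Some (vs, s)"
  then have "\<exists>r. evals P env es (fst r) (snd r)" "(SOME r. evals P env es (fst r) (snd r)) = (vs, s)"
    unfolding run_args_def by (auto split: if_splits)
  then show "evals P env es vs s"
    by (metis fst_conv snd_conv someI_ex)
next
  assume *: "evals P env es vs s"
  then have "\<exists>r. evals P env es (fst r) (snd r)" by auto
  moreover from someI_ex[OF this] have "(SOME r. evals P env es (fst r) (snd r)) = (vs, s)"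
    using eval_deterministic_aux(2)[OF *] by (metis prod.collapse)
  ultimately show "run_args P env es = Some (vs, s)" unfolding run_args_def by presburger
qed

lemma option_prod_eqI:
  "(\<And>x y. a = Some (x, y) \<longleftrightarrow> b = Some (x, y)) \<Longrightarrow> a = b"
  by (metis not_None_eq surj_pair)

lemma case_val_eq_Some_iff:
  "(case x of Num n \<Rightarrow> f n | Cell y z \<Rightarrow> g y z) = Some r \<longleftrightarrow>
     (\<exists>n. x = Num n \<and> f n = Some r) \<or> (\<exists>y z. x = Cell y z \<and> g y z = Some r)"
  by (cases x) auto

lemma run_simps [simp]:
  "run P env (Var i) = (if i < length env then Some (env ! i, 1) else None)"
  "run P env (Lit n) = Some (Num n, 1)"
  "run P env (MkCell a b) =
     Option.bind (run P env a) (\<lambda>(x, s). Option.bind (run P env b) (\<lambda>(y, t).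
       Some (Cell x y, s + t + 1)))"
  "run P env (Fst a) =
     Option.bind (run P env a) (\<lambda>(x, s). case x of Num n \<Rightarrow> None | Cell y z \<Rightarrow> Some (y, s + 1))"
  "run P env (Snd a) =
     Option.bind (run P env a) (\<lambda>(x, s). case x of Num n \<Rightarrow> None | Cell y z \<Rightarrow> Some (z, s + 1))"
  "run P env (IsNum a) =
     Option.bind (run P env a)
       (\<lambda>(x, s). case x of Num n \<Rightarrow> Some (Num 1, s + 1) | Cell y z \<Rightarrow> Some (Num 0, s + 1))"
  "run P env (Add a b) =
     Option.bind (run P env a) (\<lambda>(x, s). Option.bind (run P env b) (\<lambda>(y, t).
       case x of Num m \<Rightarrow> (case y of Num n \<Rightarrow> Some (Num (m + n), s + t + 1) | Cell _ _ \<Rightarrow> None)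
       | Cell _ _ \<Rightarrow> None))"
  "run P env (Monus a b) =
     Option.bind (run P env a) (\<lambda>(x, s). Option.bind (run P env b) (\<lambda>(y, t).
       case x of Num m \<Rightarrow> (case y of Num n \<Rightarrow> Some (Num (m - n), s + t + 1) | Cell _ _ \<Rightarrow> None)
       | Cell _ _ \<Rightarrow> None))"
  "run P env (IfZero c a b) =
     Option.bind (run P env c) (\<lambda>(x, s).
       case x of
         Num n \<Rightarrow> Option.bind (run P env (if n = 0 then a else b)) (\<lambda>(y, t). Some (y, s + t + 1))
       | Cell _ _ \<Rightarrow> None)"
  "run P env (Bind a b) =
     Option.bind (run P env a) (\<lambda>(x, s). Option.bind (run P (x # env) b) (\<lambda>(y, t).
       Some (y, s + t + 1)))"
  "run P env (Call f as) =
     Option.bind (run_args P env as) (\<lambda>(xs, s).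
       if f < length P then Option.bind (run P xs (P ! f)) (\<lambda>(y, t). Some (y, s + t + 1)) else None)"
  "run_args P env [] = Some ([], 0)"
  "run_args P env (a # as) =
     Option.bind (run P env a) (\<lambda>(x, s). Option.bind (run_args P env as) (\<lambda>(xs, t).
       Some (x # xs, s + t)))"
  by (rule option_prod_eqI;
      force simp: run_eq_Some_iff run_args_eq_Some_iff eval_iff bind_eq_Some_conv
        case_val_eq_Some_iff gr0_conv_Suc)+

section \<open>The program\<close>

text \<open>Variable \<open>i\<close> of a function body is its \<open>i\<close>-th argument, until \<^const>\<open>Bind\<close> shifts the indices.\<close>

abbreviation (input) IfNil :: "exp \<Rightarrow> exp \<Rightarrow> exp \<Rightarrow> exp" where
  "IfNil e a b \<equiv> IfZero (IsNum e) b a"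

abbreviation (input) IfEq :: "exp \<Rightarrow> exp \<Rightarrow> exp \<Rightarrow> exp \<Rightarrow> exp" where
  "IfEq a b c d \<equiv> IfZero (Add (Monus a b) (Monus b a)) c d"

abbreviation (input) "OUTPUT \<equiv> 1 :: nat"
abbreviation (input) "LOOKUP \<equiv> 2 :: nat"
abbreviation (input) "MEMBER \<equiv> 3 :: nat"
abbreviation (input) "FILTER \<equiv> 4 :: nat"
abbreviation (input) "CANDS \<equiv> 5 :: nat"
abbreviation (input) "LOWER \<equiv> 6 :: nat"
abbreviation (input) "APPEND \<equiv> 7 :: nat"
abbreviation (input) "DESCEND \<equiv> 8 :: nat"
abbreviation (input) "GATHER \<equiv> 9 :: nat"
abbreviation (input) "FORGET \<equiv> 10 :: nat"
abbreviation (input) "BEST \<equiv> 11 :: nat"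
abbreviation (input) "TABLE \<equiv> 12 :: nat"
abbreviation (input) "BRANCH \<equiv> 13 :: nat"
abbreviation (input) "SOLVE \<equiv> 14 :: nat"
abbreviation (input) "SOLVES \<equiv> 15 :: nat"

definition main_body :: exp where
  "main_body =
    Call OUTPUT [Fst (Var 0), Snd (Snd (Call SOLVE [Fst (Var 0), Lit 0, Snd (Var 0)]))]"

definition lookup_body :: exp where
  "lookup_body =
    IfNil (Var 1) (Lit 0)
      (IfEq (Var 0) (Fst (Fst (Var 1))) (Snd (Fst (Var 1))) (Call LOOKUP [Var 0, Snd (Var 1)]))"

definition member_body :: exp where
  "member_body =
    IfNil (Var 1) (Lit 0)
      (IfEq (Var 0) (Fst (Var 1)) (Lit 1) (Call MEMBER [Var 0, Snd (Var 1)]))"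

\<comment> \<open>arguments: 1 to keep the common elements or 0 to remove them, list, other list\<close>
definition filter_body :: exp where
  "filter_body =
    IfNil (Var 1) (Lit 0)
      (IfEq (Var 0) (Call MEMBER [Fst (Var 1), Var 2])
        (MkCell (Fst (Var 1)) (Call FILTER [Var 0, Snd (Var 1), Var 2]))
        (Call FILTER [Var 0, Snd (Var 1), Var 2]))"

\<comment> \<open>arguments: adjacency list, accumulator\<close>
definition cands_body :: exp where
  "cands_body =
    IfNil (Var 0) (Var 1)
      (Call CANDS [Snd (Var 0),
        IfZero (Call MEMBER [Snd (Fst (Var 0)), Var 1])
          (MkCell (Snd (Fst (Var 0))) (Var 1)) (Var 1)])"

\<comment> \<open>arguments: graph, vertex, assignment\<close>
definition lower_body :: exp where
  "lower_body =
    IfNil (Var 2) (Lit 0)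
      (Bind (Call LOWER [Var 0, Var 1, Snd (Var 2)])
        (IfZero (Monus (Call LOOKUP [Var 2, Call LOOKUP [Fst (Fst (Var 3)), Var 1]])
                   (Snd (Fst (Var 3))))
          (Var 0)
          (Bind (Call LOOKUP [Fst (Fst (Var 3)), Call LOOKUP [Var 2, Var 1]])
            (Add (Var 0) (Monus (Var 1) (Var 0))))))"

definition append_body :: exp where
  "append_body =
    IfNil (Var 0) (Var 1) (MkCell (Fst (Var 0)) (Call APPEND [Snd (Var 0), Var 1]))"

\<comment> \<open>arguments: vertices, assignment, table\<close>
definition descend_body :: exp where
  "descend_body =
    IfNil (Var 0) (Var 2)
      (Call DESCEND [Snd (Var 0), Var 1,
        Call LOOKUP [Call LOOKUP [Fst (Var 0), Var 1], Var 2]])"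

\<comment> \<open>arguments: assignment, tables\<close>
definition gather_body :: exp where
  "gather_body =
    IfNil (Var 1) (MkCell (Lit 0) (Lit 0))
      (Bind (Call DESCEND [Fst (Fst (Var 1)), Var 0, Snd (Fst (Var 1))])
        (Bind (Call GATHER [Var 1, Snd (Var 2)])
          (MkCell (Add (Fst (Var 1)) (Fst (Var 0))) (Call APPEND [Snd (Var 1), Snd (Var 0)]))))"

\<comment> \<open>arguments: graph, vertices, assignment, tables\<close>
definition forget_body :: exp where
  "forget_body =
    IfNil (Var 1) (Call GATHER [Var 2, Var 3])
      (Call BEST [Var 0, Snd (Var 1), Var 2, Var 3, Fst (Var 1),
        Call CANDS [Call LOOKUP [Fst (Var 1), Var 0], MkCell (Lit 0) (Lit 0)]])"

\<comment> \<open>arguments: graph, vertices, assignment, tables, vertex, candidates\<close>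
definition best_body :: exp where
  "best_body =
    Bind (Call LOWER [Var 0, Var 4, Var 2])
      (Bind (Add (Var 0) (Monus (Fst (Var 6)) (Var 0)))
        (Bind (Call FORGET [Var 2, Var 3, MkCell (MkCell (Var 6) (Var 0)) (Var 4), Var 5])
          (Bind (MkCell (Add (Var 1) (Fst (Var 0))) (MkCell (MkCell (Var 7) (Var 1)) (Snd (Var 0))))
            (IfNil (Snd (Var 9)) (Var 0)
              (Bind (Call BEST [Var 4, Var 5, Var 6, Var 7, Var 8, Snd (Var 9)])
                (IfZero (Monus (Fst (Var 1)) (Fst (Var 0))) (Var 1) (Var 0)))))))"

\<comment> \<open>arguments: graph, branching vertices, forgotten vertices, assignment, tables\<close>
definition table_body :: exp where
  "table_body =
    IfNil (Var 1) (Call FORGET [Var 0, Var 2, Var 3, Var 4])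
      (Call BRANCH [Var 0, Snd (Var 1), Var 2, Var 3, Var 4, Fst (Var 1),
        Call CANDS [Call LOOKUP [Fst (Var 1), Var 0], MkCell (Lit 0) (Lit 0)]])"

\<comment> \<open>arguments: like TABLE, then vertex, candidates\<close>
definition branch_body :: exp where
  "branch_body =
    IfNil (Var 6) (Lit 0)
      (MkCell
        (MkCell (Fst (Var 6))
          (Call TABLE [Var 0, Var 1, Var 2, MkCell (MkCell (Var 5) (Fst (Var 6))) (Var 3), Var 4]))
        (Call BRANCH [Var 0, Var 1, Var 2, Var 3, Var 4, Var 5, Snd (Var 6)]))"

\<comment> \<open>arguments: graph, parent bag, decomposition\<close>
definition solve_body :: exp where
  "solve_body =
    Bind (Call FILTER [Lit 1, Fst (Var 2), Var 1])
      (MkCell (Var 0)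
        (Call TABLE [Var 1, Var 0, Call FILTER [Lit 0, Fst (Var 3), Var 2], Lit 0,
          Call SOLVES [Var 1, Fst (Var 3), Snd (Var 3)]]))"

\<comment> \<open>arguments: graph, parent bag, decompositions\<close>
definition solves_body :: exp where
  "solves_body =
    IfNil (Var 2) (Lit 0)
      (MkCell (Call SOLVE [Var 0, Var 1, Fst (Var 2)]) (Call SOLVES [Var 0, Var 1, Snd (Var 2)]))"

definition output_body :: exp where
  "output_body =
    IfNil (Var 0) (Lit 0)
      (MkCell (MkCell (Fst (Fst (Var 0))) (Call LOOKUP [Fst (Fst (Var 0)), Var 1]))
        (Call OUTPUT [Snd (Var 0), Var 1]))"

definition dp_prog :: prog where
  "dp_prog =
    [main_body, output_body, lookup_body, member_body, filter_body, cands_body, lower_body, append_body, descend_body, gather_body, forget_body, best_body, table_body, branch_body, solve_body, solves_body]"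

lemma dp_length: "length dp_prog = 16"
  by (simp add: dp_prog_def)

definition call :: "nat \<Rightarrow> val list \<Rightarrow> (val \<times> nat) option" where
  "call f xs = run dp_prog xs (dp_prog ! f)"

text \<open>Execution stops at the opaque \<open>call\<close>, so that a callee is not unfolded but
  rewritten by a fact about its result.\<close>

lemma run_dp_Call [simp]:
  "run dp_prog env (Call f as) =
     Option.bind (run_args dp_prog env as) (\<lambda>(xs, s).
       if f < 16 then Option.bind (call f xs) (\<lambda>(y, t). Some (y, s + t + 1)) else None)"
  unfolding call_def by (simp add: dp_length)

declare run_simps(11) [simp del]

text \<open>Keeps the simplifier from entering continuations before their argument is known.\<close>

lemma bind_weak_cong [cong]: "m = m' \<Longrightarrow> Option.bind m f = Option.bind m' f"
  by simp


lemma call_bodies: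
  "call OUTPUT = (\<lambda>xs. run dp_prog xs output_body)"
  "call LOOKUP = (\<lambda>xs. run dp_prog xs lookup_body)"
  "call MEMBER = (\<lambda>xs. run dp_prog xs member_body)"
  "call FILTER = (\<lambda>xs. run dp_prog xs filter_body)"
  "call CANDS = (\<lambda>xs. run dp_prog xs cands_body)"
  "call LOWER = (\<lambda>xs. run dp_prog xs lower_body)"
  "call APPEND = (\<lambda>xs. run dp_prog xs append_body)"
  "call DESCEND = (\<lambda>xs. run dp_prog xs descend_body)"
  "call GATHER = (\<lambda>xs. run dp_prog xs gather_body)"
  "call FORGET = (\<lambda>xs. run dp_prog xs forget_body)"
  "call BEST = (\<lambda>xs. run dp_prog xs best_body)"
  "call TABLE = (\<lambda>xs. run dp_prog xs table_body)"
  "call BRANCH = (\<lambda>xs. run dp_prog xs branch_body)"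
  "call SOLVE = (\<lambda>xs. run dp_prog xs solve_body)"
  "call SOLVES = (\<lambda>xs. run dp_prog xs solves_body)"
  by (simp_all add: call_def dp_prog_def fun_eq_iff)

lemmas call_unfold = call_bodies output_body_def lookup_body_def member_body_def filter_body_def cands_body_def lower_body_def append_body_def descend_body_def gather_body_def forget_body_def best_body_def table_body_def branch_body_def solve_body_def solves_body_def

text \<open>The exact number of steps depends on the data and is hidden; only an upper bound is
  passed on to callers.\<close>

definition returns :: "nat \<Rightarrow> val list \<Rightarrow> val \<Rightarrow> nat \<Rightarrow> bool" where
  "returns f xs v b \<longleftrightarrow> (\<exists>s\<le>b. call f xs = Some (v, s))"

lemma returnsE:
  assumes "returns f xs v b"
  obtains s where "s \<le> b" "call f xs = Some (v, s)"
  using assms unfolding returns_def by blast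

lemma returns_mono: "returns f xs v b \<Longrightarrow> b \<le> b' \<Longrightarrow> returns f xs v b'"
  unfolding returns_def by (meson order_trans)

section \<open>Basic functions\<close>

text \<open>The graph, adjacency lists, assignments and inner nodes of tries all have this format,
  so a single \<open>LOOKUP\<close> serves them.\<close>

definition enc_map :: "('b \<Rightarrow> val) \<Rightarrow> (nat \<times> 'b) list \<Rightarrow> val" where
  "enc_map e xs = enc_list (map (\<lambda>(k, x). Cell (Num k) (e x)) xs)"

lemma enc_map_simps [simp]:
  "enc_map e [] = Num 0"
  "enc_map e ((k, x) # xs) = Cell (Cell (Num k) (e x)) (enc_map e xs)"
  by (auto simp: enc_map_def)

abbreviation enc_nats :: "nat list \<Rightarrow> val" where
  "enc_nats xs \<equiv> enc_list (map Num xs)"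

text \<open>A failed search yields \<open>Num 0\<close>, which is both the number 0 and the empty
  list; the assumption makes it the encoding of the default \<open>d\<close>.\<close>

lemma returns_LOOKUP:
  assumes "e d = Num 0"
  shows "returns LOOKUP [Num k, enc_map e xs] (e (look d xs k)) (20 * length xs + 20)"
proof (induction xs)
  case Nil
  show ?case unfolding returns_def call_unfold using assms by simp
next
  case (Cons x xs)
  obtain k' y where x: "x = (k', y)" by force
  from Cons obtain s where "s \<le> 20 * length xs + 20"
    "call LOOKUP [Num k, enc_map e xs] = Some (e (look d xs k), s)" by (rule returnsE)
  note s = this
  show ?case unfolding returns_def call_unfold using x s by simp
qed

lemma returns_MEMBER:
  "returns MEMBER [Num x, enc_nats xs] (Num (of_bool (x \<in> set xs))) (20 * length xs + 20)"
proof (induction xs)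
  case Nil
  show ?case unfolding returns_def call_unfold by simp
next
  case (Cons y xs)
  from Cons obtain s where s: "s \<le> 20 * length xs + 20"
    "call MEMBER [Num x, enc_nats xs] = Some (Num (of_bool (x \<in> set xs)), s)" by (rule returnsE)
  show ?case unfolding returns_def call_unfold using s by auto
qed

lemma returns_FILTER:
  "returns FILTER [Num b, enc_nats ys, enc_nats xs]
     (enc_nats (filter (\<lambda>y. of_bool (y \<in> set xs) = b) ys)) (100 * (length xs + 1) * (length ys + 1))"
proof (induction ys)
  case Nil
  show ?case unfolding returns_def call_unfold by simp
next
  case (Cons y ys)
  from Cons obtain s where s: "s \<le> 100 * (length xs + 1) * (length ys + 1)"
    "call FILTER [Num b, enc_nats ys, enc_nats xs] =
       Some (enc_nats (filter (\<lambda>y. of_bool (y \<in> set xs) = b) ys), s)" by (rule returnsE)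
  obtain t where t: "t \<le> 20 * length xs + 20"
    "call MEMBER [Num y, enc_nats xs] = Some (Num (of_bool (y \<in> set xs)), t)"
    using returns_MEMBER by (rule returnsE)
  show ?case unfolding returns_def call_unfold using s t by (auto simp: algebra_simps)
qed

text \<open>The accumulator grows by at most one per element read, so
  \<open>length xs + length acc\<close> never increases and bounds every membership test.\<close>

lemma returns_CANDS:
  "returns CANDS [enc_map Num xs, enc_nats acc]
     (enc_nats (fold (\<lambda>(u, x). List.insert x) xs acc))
     (40 * (length xs + length acc + 1) * (length xs + 1))"
proof (induction xs arbitrary: acc)
  case Nil
  show ?case unfolding returns_def call_unfold by simp
next
  case (Cons y xs)
  obtain k x where y: "y = (k, x)" by force
  obtain t where t: "t \<le> 20 * length acc + 20"
    "call MEMBER [Num x, enc_nats acc] = Some (Num (of_bool (x \<in> set acc)), t)"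
    using returns_MEMBER by (rule returnsE)
  let ?acc = "List.insert x acc"
  from Cons obtain s where s: "s \<le> 40 * (length xs + length ?acc + 1) * (length xs + 1)"
    "call CANDS [enc_map Num xs, enc_nats ?acc] =
       Some (enc_nats (fold (\<lambda>(u, x). List.insert x) xs ?acc), s)" by (rule returnsE)
  have "length ?acc \<le> length acc + 1" by (simp add: List.insert_def)
  then have "40 * (length xs + length ?acc + 1) * (length xs + 1)
      \<le> 40 * (length xs + length acc + 2) * (length xs + 1)"
    by (intro mult_mono) auto
  with s(1) have "s \<le> 40 * (length xs + length acc + 2) * (length xs + 1)" by linarith
  then show ?case unfolding returns_def call_unfold using s(2) t
    by (cases "x \<in> set acc") (auto simp: algebra_simps y List.insert_def)
qed

lemma returns_APPEND:
  "returns APPEND [enc_map Num xs, enc_map Num ys] (enc_map Num (xs @ ys)) (20 * length xs + 20)"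
proof (induction xs)
  case Nil
  show ?case unfolding returns_def call_unfold by simp
next
  case (Cons y xs)
  obtain k x where y: "y = (k, x)" by force
  from Cons obtain s where s: "s \<le> 20 * length xs + 20"
    "call APPEND [enc_map Num xs, enc_map Num ys] = Some (enc_map Num (xs @ ys), s)"
    by (rule returnsE)
  show ?case unfolding returns_def call_unfold using s by (auto simp: y)
qed

lemma returns_OUTPUT:
  "returns OUTPUT [enc_map e g, enc_map Num sol]
     (enc_map Num (map (\<lambda>(v, a). (v, val_of sol v)) g)) (40 * (length sol + 1) * (length g + 1))"
proof (induction g)
  case Nil
  show ?case unfolding returns_def call_unfold by simp
next
  case (Cons y g)
  obtain v a where y: "y = (v, a)" by force
  obtain t where t: "t \<le> 20 * length sol + 20"
    "call LOOKUP [Num v, enc_map Num sol] = Some (Num (val_of sol v), t)"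
    using returns_LOOKUP[where e = Num] by (rule returnsE) auto
  from Cons obtain s where s: "s \<le> 40 * (length sol + 1) * (length g + 1)"
    "call OUTPUT [enc_map e g, enc_map Num sol] =
       Some (enc_map Num (map (\<lambda>(v, a). (v, val_of sol v)) g), s)"
    by (rule returnsE)
  show ?case unfolding returns_def call_unfold using s t by (auto simp: y algebra_simps)
qed


section \<open>Running time\<close>

definition enc_result :: "nat \<times> assignment \<Rightarrow> val" where
  "enc_result r = Cell (Num (fst r)) (enc_map Num (snd r))"

text \<open>Tables are stored as tries, since searching a list of all entries would take exponential time.\<close>

primrec enc_tab :: "graph \<Rightarrow> (assignment \<Rightarrow> nat \<times> assignment) \<Rightarrow> nat list \<Rightarrow> assignment \<Rightarrow> val"
where
  "enc_tab g F [] h = enc_result (F h)"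
| "enc_tab g F (v # A) h = enc_map id (map (\<lambda>a. (a, enc_tab g F A ((v, a) # h))) (cands g v))"

definition enc_table :: "graph \<Rightarrow> table \<Rightarrow> val" where
  "enc_table g t = Cell (enc_nats (fst t)) (enc_tab g (snd t) (fst t) [])"

text \<open>This is how the program computes a maximum with only addition and truncated
  subtraction.\<close>

lemma add_diff_eq_max: "x + (y - x) = max x y" for x y :: nat
  by simp

text \<open>\<open>L\<close> bounds the polynomial quantities and \<open>D\<close> the number of
  branches, so all costs become a polynomial in \<open>L\<close> times a power of \<open>D\<close>.
  The strict inequality in \<open>length_adj\<close> leaves room for the additional candidate
  0.\<close>

locale bounded_graph =
  fixes g :: graph and L D :: nat
  assumes length_graph: "length g \<le> L"
    and length_adj: "length (look [] g v) < L"
    and length_cands: "length (cands g v) \<le> D"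
begin

text \<open>Tries have branches for candidate values only, so these are the assignments for which
  descending succeeds. Unassigned vertices count as 0, which is always a candidate.\<close>

definition admissible :: "assignment \<Rightarrow> bool" where
  "admissible f \<longleftrightarrow> (\<forall>v. val_of f v \<in> set (cands g v))"

lemma admissible_Nil: "admissible []"
  by (simp add: admissible_def zero_in_cands)

lemma admissible_Cons: "admissible f \<Longrightarrow> b \<in> set (cands g v) \<Longrightarrow> admissible ((v, b) # f)"
  by (simp add: admissible_def)

lemma L_pos: "1 \<le> L"
  using length_adj[of 0] by linarith

lemma D_pos: "1 \<le> D"
  using length_cands[of 0] cands_not_Nil[of g 0] by (cases "cands g 0") auto

lemma length_cands_le_L: "length (cands g v) \<le> L"
  using length_cands_le[of g v] length_adj[of v] by linarith

abbreviation "enc_g \<equiv> enc_map (enc_map Num) g"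

lemma returns_adjacency: "returns LOOKUP [Num v, enc_g] (enc_map Num (look [] g v)) (40 * L)"
  using returns_LOOKUP[of "enc_map Num" "[]" v g] length_graph L_pos
  by (auto elim!: returns_mono)

lemma returns_weight:
  "returns LOOKUP [Num v, enc_map Num (look [] g u)] (Num (wt g u v)) (40 * L)"
  using returns_LOOKUP[of Num 0 v "look [] g u"] length_adj[of u] L_pos
  by (auto simp: wt_def elim!: returns_mono)

lemma returns_LOWER:
  "returns LOWER [enc_g, Num v, enc_map Num f] (Num (lower g v f)) (300 * L * (length f + 1))"
proof (induction f)
  case Nil
  show ?case unfolding returns_def call_unfold using L_pos by simp
next
  case (Cons y f)
  obtain u b where y: "y = (u, b)" by force
  from Cons obtain s where s: "s \<le> 300 * L * (length f + 1)"
    "call LOWER [enc_g, Num v, enc_map Num f] = Some (Num (lower g v f), s)" by (rule returnsE)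
  obtain t1 where t1: "t1 \<le> 40 * L"
    "call LOOKUP [Num u, enc_g] = Some (enc_map Num (look [] g u), t1)"
    using returns_adjacency by (rule returnsE)
  obtain t2 where t2: "t2 \<le> 40 * L"
    "call LOOKUP [Num v, enc_g] = Some (enc_map Num (look [] g v), t2)"
    using returns_adjacency by (rule returnsE)
  obtain t3 where t3: "t3 \<le> 40 * L"
    "call LOOKUP [Num v, enc_map Num (look [] g u)] = Some (Num (wt g u v), t3)"
    using returns_weight by (rule returnsE)
  obtain t4 where t4: "t4 \<le> 40 * L"
    "call LOOKUP [Num u, enc_map Num (look [] g v)] = Some (Num (wt g v u), t4)"
    using returns_weight by (rule returnsE)
  show ?case unfolding returns_def call_unfold using s t1 t2 t3 t4 L_pos
    by (auto simp: y algebra_simps max_def)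
qed

lemma returns_CANDS_graph:
  "returns CANDS [enc_map Num (look [] g v), Cell (Num 0) (Num 0)] (enc_nats (cands g v)) (80 * L\<^sup>2)"
proof -
  have "40 * (length (look [] g v) + length [0] + 1) * (length (look [] g v) + 1) \<le> 40 * (L + L) * L"
    using length_adj[of v] L_pos by (intro mult_mono) auto
  also have "\<dots> = 80 * L\<^sup>2" by (simp add: power2_eq_square)
  finally show ?thesis
    using returns_CANDS[of "look [] g v" "[0]"] by (auto simp: cands_def elim!: returns_mono)
qed

text \<open>\<open>h\<close> is the path already taken from the root of the trie. Each level scans
  \<open>f\<close> and at most \<open>L\<close> siblings, however many entries the table
  has.\<close>

lemma returns_DESCEND:
  assumes "admissible f"
  shows "returns DESCEND [enc_nats A, enc_map Num f, enc_tab g F A h]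
    (enc_result (F (rev (map (\<lambda>v. (v, val_of f v)) A) @ h))) (60 * (length f + L + 1) * (length A + 1))"
proof (induction A arbitrary: h)
  case Nil
  show ?case unfolding returns_def call_unfold by simp
next
  case (Cons v A)
  let ?a = "val_of f v"
  let ?tab = "enc_tab g F (v # A) h"
  obtain t1 where t1: "t1 \<le> 20 * length f + 20"
    "call LOOKUP [Num v, enc_map Num f] = Some (Num ?a, t1)"
    using returns_LOOKUP[where e = Num] by (rule returnsE) auto
  have "returns LOOKUP [Num ?a, ?tab] (enc_tab g F A ((v, ?a) # h)) (20 * L + 20)"
    using returns_LOOKUP[of id "Num 0" ?a "map (\<lambda>a. (a, enc_tab g F A ((v, a) # h))) (cands g v)"]
      assms length_cands_le_L[of v]
    by (auto simp: look_map admissible_def elim!: returns_mono)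
  then obtain t2 where t2: "t2 \<le> 20 * L + 20"
    "call LOOKUP [Num ?a, ?tab] = Some (enc_tab g F A ((v, ?a) # h), t2)"
    by (rule returnsE)
  obtain s where s: "s \<le> 60 * (length f + L + 1) * (length A + 1)"
    "call DESCEND [enc_nats A, enc_map Num f, enc_tab g F A ((v, ?a) # h)] =
      Some (enc_result (F (rev (map (\<lambda>v. (v, val_of f v)) A) @ (v, ?a) # h)), s)"
    using Cons by (rule returnsE)
  show ?case unfolding returns_def call_unfold using t1 t2 s
    by (simp add: algebra_simps del: enc_tab.simps)
qed


text \<open>The bound \<open>L\<^sup>2\<close> comes from at most \<open>L\<close> nodes below, each
  contributing at most the vertices of its bag. Counting in this way keeps the running time
  independent of correctness.\<close>

definition small_tables :: "table list \<Rightarrow> bool" where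
  "small_tables tbs \<longleftrightarrow> length tbs \<le> L \<and>
     (\<forall>(A, F)\<in>set tbs. length A \<le> L \<and> (\<forall>h. length (snd (F h)) \<le> L\<^sup>2))"

lemma powers_L: "1 \<le> L\<^sup>2" "L \<le> L\<^sup>2" "L\<^sup>2 \<le> L ^ 3" "1 \<le> L ^ 3" "L \<le> L ^ 3"
  using L_pos by (auto simp: power2_eq_square power3_eq_cube)

lemma returns_GATHER_aux:
  assumes "admissible f" and "length f \<le> L"
    and "\<forall>(A, F)\<in>set tbs. length A \<le> L \<and> (\<forall>h. length (snd (F h)) \<le> L\<^sup>2)"
  shows "returns GATHER [enc_map Num f, enc_list (map (enc_table g) tbs)]
    (enc_result (gather f tbs)) (500 * L\<^sup>2 * (length tbs + 1))"
  using assms(3)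
proof (induction tbs)
  case Nil
  show ?case unfolding returns_def call_unfold using powers_L by (simp add: enc_result_def)
next
  case (Cons tb tbs)
  obtain A F where tb: "tb = (A, F)" by force
  let ?r = "F (rev (map (\<lambda>v. (v, val_of f v)) A))"
  have A: "length A \<le> L" and F: "length (snd ?r) \<le> L\<^sup>2"
    using Cons.prems by (auto simp: tb)
  obtain s where s: "s \<le> 500 * L\<^sup>2 * (length tbs + 1)"
    "call GATHER [enc_map Num f, enc_list (map (enc_table g) tbs)] = Some (enc_result (gather f tbs), s)"
    using Cons by (auto elim: returnsE)
  have "60 * (length f + L + 1) * (length A + 1) \<le> 60 * (L + L + L) * (L + L)"
    using A assms(2) L_pos by (intro mult_mono) auto
  also have "\<dots> = 360 * L\<^sup>2" by (simp add: power2_eq_square)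
  finally obtain t where t: "t \<le> 360 * L\<^sup>2"
    "call DESCEND [enc_nats A, enc_map Num f, enc_tab g F A []] = Some (enc_result ?r, t)"
    using returns_DESCEND[OF assms(1), of A F "[]"] by (auto elim!: returnsE)
  obtain t' where t': "t' \<le> 20 * length (snd ?r) + 20"
    "call APPEND [enc_map Num (snd ?r), enc_map Num (snd (gather f tbs))] =
       Some (enc_map Num (snd ?r @ snd (gather f tbs)), t')"
    using returns_APPEND by (rule returnsE)
  have "t' \<le> 20 * L\<^sup>2 + 20" using t'(1) F by linarith
  then show ?case unfolding returns_def call_unfold using s t t'(2) powers_L
    by (simp add: tb enc_table_def enc_result_def Let_def algebra_simps)
qed

lemma returns_GATHER:
  assumes "admissible f" and "length f \<le> L" and "small_tables tbs"
  shows "returns GATHER [enc_map Num f, enc_list (map (enc_table g) tbs)]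
    (enc_result (gather f tbs)) (1000 * L ^ 3)"
proof -
  have "500 * L\<^sup>2 * (length tbs + 1) \<le> 500 * L\<^sup>2 * (L + L)"
    using assms(3) L_pos by (intro mult_mono) (auto simp: small_tables_def)
  also have "\<dots> = 1000 * L ^ 3" by (simp add: power2_eq_square power3_eq_cube)
  finally show ?thesis
    using assms(3) by (intro returns_mono[OF returns_GATHER_aux[OF assms(1,2)]]) (simp_all add: small_tables_def)
qed

text \<open>Solves the recurrence for \<open>Suc m\<close> nested branchings over leaves of cost
  \<open>X\<close>: at most \<open>D\<close> branches with overhead \<open>700 * L\<^sup>2\<close>
  each, and \<open>300 * L\<^sup>2\<close> outside them. The overhead of a level is charged
  \<open>D ^ Suc m\<close> times, as if it arose at the leaves; thus \<open>m\<close> enters as a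
  factor and \<open>D = 1\<close> is no special case.\<close>

lemma branching_cost:
  assumes "s \<le> d * (D ^ m * (X + m * (1000 * L\<^sup>2)) + 700 * L\<^sup>2) + 300 * L\<^sup>2" and "d \<le> D"
  shows "s \<le> D ^ Suc m * (X + Suc m * (1000 * L\<^sup>2))"
proof -
  let ?C = "D ^ m * (X + m * (1000 * L\<^sup>2))"
  note assms(1)
  also have "d * (?C + 700 * L\<^sup>2) + 300 * L\<^sup>2 \<le> D * (?C + 700 * L\<^sup>2) + D * (300 * L\<^sup>2)"
    using assms(2) D_pos by (intro add_mono mult_right_mono) auto
  also have "\<dots> = D * ?C + D * (1000 * L\<^sup>2)" by (simp add: algebra_simps)
  also have "\<dots> \<le> D * ?C + D ^ Suc m * (1000 * L\<^sup>2)"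
    using D_pos by (intro add_left_mono mult_right_mono) auto
  also have "\<dots> = D ^ Suc m * (X + Suc m * (1000 * L\<^sup>2))" by (simp add: algebra_simps)
  finally show ?thesis .
qed

lemma returns_FORGET:
  assumes "small_tables tbs" and "admissible f" and "length f + length B \<le> L"
  shows "returns FORGET [enc_g, enc_nats B, enc_map Num f, enc_list (map (enc_table g) tbs)]
    (enc_result (forget g (\<lambda>f. gather f tbs) B f))
    (D ^ length B * (1100 * L ^ 3 + length B * (1000 * L\<^sup>2)))"
  using assms(2,3)
proof (induction B arbitrary: f)
  case Nil
  obtain s where s: "s \<le> 1000 * L ^ 3"
    "call GATHER [enc_map Num f, enc_list (map (enc_table g) tbs)] = Some (enc_result (gather f tbs), s)"
    using returns_GATHER[OF Nil(1) _ assms(1)] Nil(2) by (auto elim: returnsE)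
  show ?case unfolding returns_def call_unfold using s powers_L by simp
next
  case (Cons v B)
  let ?tbs = "enc_list (map (enc_table g) tbs)"
  let ?b = "\<lambda>a. max (lower g v f) a"
  let ?r = "\<lambda>a. forget g (\<lambda>f. gather f tbs) B ((v, ?b a) # f)"
  let ?r' = "\<lambda>a. (?b a + fst (?r a), (v, ?b a) # snd (?r a))"
  let ?C = "D ^ length B * (1100 * L ^ 3 + length B * (1000 * L\<^sup>2))"
  obtain t1 where t1: "t1 \<le> 300 * L * (length f + 1)"
    "call LOWER [enc_g, Num v, enc_map Num f] = Some (Num (lower g v f), t1)"
    using returns_LOWER by (rule returnsE)
  have "300 * L * (length f + 1) \<le> 300 * L * (L + L)"
    using Cons.prems(2) by (intro mult_mono) auto
  also have "\<dots> = 600 * L\<^sup>2" by (simp add: power2_eq_square)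
  finally have t1': "t1 \<le> 600 * L\<^sup>2" using t1(1) by linarith
  \<comment> \<open>\<open>LOWER\<close> is evaluated anew for every candidate and takes 600 of the
    700; the other 100 pay for the constant number of remaining steps.\<close>
  have best: "returns BEST [enc_g, enc_nats B, enc_map Num f, ?tbs, Num v, enc_nats cs]
      (enc_result (arg_min_list fst (map ?r' cs))) (length cs * (?C + 700 * L\<^sup>2))"
    if "cs \<noteq> []" "set cs \<subseteq> set (cands g v)" for cs
    using that
  proof (induction cs rule: list_nonempty_induct)
    case (single a)
    have "?b a \<in> set (cands g v)" using single lower_in_cands[of g v f] by (auto simp: max_def)
    then obtain t where t: "t \<le> ?C"
      "call FORGET [enc_g, enc_nats B, enc_map Num ((v, ?b a) # f), ?tbs] = Some (enc_result (?r a), t)"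
      using Cons.IH[of "(v, ?b a) # f"] Cons.prems by (auto simp: admissible_Cons elim: returnsE)
    show ?case unfolding returns_def call_unfold using t t1(2) t1' powers_L
      by (simp add: enc_result_def add_diff_eq_max)
  next
    case (cons a cs)
    have "?b a \<in> set (cands g v)" using cons lower_in_cands[of g v f] by (auto simp: max_def)
    then obtain t where t: "t \<le> ?C"
      "call FORGET [enc_g, enc_nats B, enc_map Num ((v, ?b a) # f), ?tbs] = Some (enc_result (?r a), t)"
      using Cons.IH[of "(v, ?b a) # f"] Cons.prems by (auto simp: admissible_Cons elim: returnsE)
    obtain s where s: "s \<le> length cs * (?C + 700 * L\<^sup>2)"
      "call BEST [enc_g, enc_nats B, enc_map Num f, ?tbs, Num v, enc_nats cs] =
        Some (enc_result (arg_min_list fst (map ?r' cs)), s)"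
      using cons by (auto elim: returnsE)
    obtain c cs' where cs: "cs = c # cs'" using cons by (cases cs) auto
    \<comment> \<open>Ties go to the earlier candidate, in \<open>BEST\<close> as in
      \<open>arg_min_list\<close>, so that the results are equal and not merely of equal
      cost.\<close>
    show ?case unfolding returns_def call_unfold using t s t1(2) t1' powers_L
      by (simp add: cs enc_result_def add_diff_eq_max Let_def)
  qed
  obtain t2 where t2: "t2 \<le> length (cands g v) * (?C + 700 * L\<^sup>2)"
    "call BEST [enc_g, enc_nats B, enc_map Num f, ?tbs, Num v, enc_nats (cands g v)] =
      Some (enc_result (arg_min_list fst (map ?r' (cands g v))), t2)"
    using best[OF cands_not_Nil order_refl] by (rule returnsE)
  obtain t3 where t3: "t3 \<le> 40 * L" "call LOOKUP [Num v, enc_g] = Some (enc_map Num (look [] g v), t3)"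
    using returns_adjacency by (rule returnsE)
  obtain t4 where t4: "t4 \<le> 80 * L\<^sup>2"
    "call CANDS [enc_map Num (look [] g v), Cell (Num 0) (Num 0)] = Some (enc_nats (cands g v), t4)"
    using returns_CANDS_graph by (rule returnsE)
  have "t2 + (t3 + t4) + 50 \<le> length (cands g v) * (?C + 700 * L\<^sup>2) + 300 * L\<^sup>2"
    using t2(1) t3(1) t4(1) powers_L by linarith
  from branching_cost[OF this length_cands]
  show ?case unfolding returns_def call_unfold using t2(2) t3(2) t4(2)
    by (simp add: Let_def)
qed

lemma returns_TABLE:
  assumes "small_tables tbs" and "admissible f" and "length f + length A + length B \<le> L"
  shows "returns TABLE [enc_g, enc_nats A, enc_nats B, enc_map Num f, enc_list (map (enc_table g) tbs)]
    (enc_tab g (forget g (\<lambda>f. gather f tbs) B) A f)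
    (D ^ (length A + length B) * (1200 * L ^ 3 + (length A + length B) * (1000 * L\<^sup>2)))"
  using assms(2,3)
proof (induction A arbitrary: f)
  case Nil
  obtain s where s: "s \<le> D ^ length B * (1100 * L ^ 3 + length B * (1000 * L\<^sup>2))"
    "call FORGET [enc_g, enc_nats B, enc_map Num f, enc_list (map (enc_table g) tbs)] =
       Some (enc_result (forget g (\<lambda>f. gather f tbs) B f), s)"
    using returns_FORGET[OF assms(1) Nil(1)] Nil(2) by (auto elim: returnsE)
  \<comment> \<open>The steps spent at a leaf of the trie are absorbed by raising the coefficient
    1100 of \<open>returns_FORGET\<close> to 1200.\<close>
  have "1 * 100 \<le> D ^ length B * (100 * L ^ 3)"
    using D_pos powers_L by (intro mult_mono) auto
  then have "s + 50 \<le> D ^ length B * (1200 * L ^ 3 + length B * (1000 * L\<^sup>2))"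
    using s(1) unfolding distrib_left by linarith
  then show ?case unfolding returns_def call_unfold using s(2) by simp
next
  case (Cons v A)
  let ?tbs = "enc_list (map (enc_table g) tbs)"
  let ?m = "length A + length B"
  let ?C = "D ^ ?m * (1200 * L ^ 3 + ?m * (1000 * L\<^sup>2))"
  note prems = Cons.prems and IH = Cons.IH
  let ?tab = "\<lambda>a. enc_tab g (forget g (\<lambda>f. gather f tbs) B) A ((v, a) # f)"
  have branch: "returns BRANCH [enc_g, enc_nats A, enc_nats B, enc_map Num f, ?tbs, Num v, enc_nats cs]
      (enc_map id (map (\<lambda>a. (a, ?tab a)) cs)) (length cs * (?C + 700 * L\<^sup>2) + 10)"
    if "set cs \<subseteq> set (cands g v)" for cs
    using that
  proof (induction cs)
    case Nil
    show ?case unfolding returns_def call_unfold by simp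
  next
    case (Cons a cs)
    then obtain t where t: "t \<le> ?C"
      "call TABLE [enc_g, enc_nats A, enc_nats B, enc_map Num ((v, a) # f), ?tbs] = Some (?tab a, t)"
      using IH[of "(v, a) # f"] prems
      by (auto simp: admissible_Cons elim: returnsE)
    have "set cs \<subseteq> set (cands g v)" using Cons.prems by simp
    from Cons.IH[OF this] obtain s where s: "s \<le> length cs * (?C + 700 * L\<^sup>2) + 10"
      "call BRANCH [enc_g, enc_nats A, enc_nats B, enc_map Num f, ?tbs, Num v, enc_nats cs] =
        Some (enc_map id (map (\<lambda>a. (a, ?tab a)) cs), s)"
      by (rule returnsE)
    show ?case unfolding returns_def call_unfold using t s powers_L by simp
  qed
  obtain t2 where t2: "t2 \<le> length (cands g v) * (?C + 700 * L\<^sup>2) + 10"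
    "call BRANCH [enc_g, enc_nats A, enc_nats B, enc_map Num f, ?tbs, Num v, enc_nats (cands g v)] =
      Some (enc_map id (map (\<lambda>a. (a, ?tab a)) (cands g v)), t2)"
    using branch[OF order_refl] by (rule returnsE)
  obtain t3 where t3: "t3 \<le> 40 * L" "call LOOKUP [Num v, enc_g] = Some (enc_map Num (look [] g v), t3)"
    using returns_adjacency by (rule returnsE)
  obtain t4 where t4: "t4 \<le> 80 * L\<^sup>2"
    "call CANDS [enc_map Num (look [] g v), Cell (Num 0) (Num 0)] = Some (enc_nats (cands g v), t4)"
    using returns_CANDS_graph by (rule returnsE)
  have "t2 + (t3 + t4) + 50 \<le> length (cands g v) * (?C + 700 * L\<^sup>2) + 300 * L\<^sup>2"
    using t2(1) t3(1) t4(1) powers_L by linarith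
  from branching_cost[OF this length_cands]
  show ?case unfolding returns_def call_unfold using t2(2) t3(2) t4(2)
    by simp
qed


end

section \<open>Sizes of decompositions and of the assignments computed from them\<close>

fun num_nodes :: "decomp \<Rightarrow> nat" where
  "num_nodes (Bag Y ts) = Suc (sum_list (map num_nodes ts))"

fun bags_le :: "nat \<Rightarrow> decomp \<Rightarrow> bool" where
  "bags_le m (Bag Y ts) \<longleftrightarrow> finite Y \<and> card Y \<le> m \<and> (\<forall>t\<in>set ts. bags_le m t)"

lemma arg_min_list_all:
  "xs \<noteq> [] \<Longrightarrow> \<forall>x\<in>set xs. P x \<Longrightarrow> P (arg_min_list f xs)"
  by (simp add: arg_min_list_in)

lemma length_forget:
  assumes "\<And>f. length (snd (h f)) \<le> m"
  shows "length (snd (forget g h B f)) \<le> length B + m"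
proof (induction B arbitrary: f)
  case (Cons v B)
  then show ?case
    using cands_not_Nil[of g v]
    by (simp add: Let_def) (rule arg_min_list_all[where P = "\<lambda>r. length (snd r) \<le> _"], auto)
qed (use assms in auto)

lemma length_filter_sorted: "finite Y \<Longrightarrow> length (filter P (sorted_list_of_set Y)) \<le> card Y"
  by (metis length_filter_le length_sorted_list_of_set)

lemma length_gather_map:
  assumes "\<And>t f. t \<in> set ts \<Longrightarrow> length (snd (snd (s t) f)) \<le> m t"
  shows "length (snd (gather f (map s ts))) \<le> sum_list (map m ts)"
  using assms
proof (induction ts)
  case (Cons t ts)
  obtain A F where "s t = (A, F)" by force
  with Cons show ?case by (auto simp: Let_def) (metis add_mono list.set_intros snd_conv)
qed auto

lemma length_solve:
  "bags_le m T \<Longrightarrow> length (snd (snd (solve g X T) f)) \<le> num_nodes T * m"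
proof (induction T arbitrary: X f)
  case (Bag Y ts)
  let ?ys = "sorted_list_of_set Y"
  have "length (snd (gather f (map (solve g ?ys) ts))) \<le> sum_list (map (\<lambda>t. num_nodes t * m) ts)" for f
    using Bag by (intro length_gather_map) auto
  then have "length (snd (snd (solve g X (Bag Y ts)) f)) \<le>
      length (filter (\<lambda>v. v \<notin> set X) ?ys) + sum_list (map (\<lambda>t. num_nodes t * m) ts)"
    by (simp add: Let_def length_forget)
  also have "length (filter (\<lambda>v. v \<notin> set X) ?ys) \<le> m"
    using Bag.prems length_filter_sorted[of Y] by (auto intro: order_trans)
  finally show ?case
    by (simp add: Let_def sum_list_mult_const)
qed

lemma length_le_num_nodes: "length ts \<le> sum_list (map num_nodes ts)"
proof (induction ts)
  case (Cons t ts)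
  then show ?case by (cases t) auto
qed auto

lemma num_nodes_le: "t \<in> set ts \<Longrightarrow> num_nodes t \<le> sum_list (map num_nodes ts)"
  by (simp add: member_le_sum_list)

context bounded_graph
begin

lemma length_fst_solve: "bags_le m T \<Longrightarrow> length (fst (solve g X T)) \<le> m"
  by (cases T) (auto simp: Let_def intro: order_trans[OF length_filter_sorted])

lemma returns_SOLVES:
  assumes "\<And>t. t \<in> set ts \<Longrightarrow>
    returns SOLVE [enc_g, enc_nats X, enc_decomp t] (enc_table g (solve g X t)) (num_nodes t * K)"
  shows "returns SOLVES [enc_g, enc_nats X, enc_list (map enc_decomp ts)]
    (enc_list (map (enc_table g) (map (solve g X) ts)))
    (sum_list (map num_nodes ts) * K + 20 * length ts + 20)"
  using assms
proof (induction ts)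
  case Nil
  show ?case unfolding returns_def call_unfold by simp
next
  case (Cons t ts)
  obtain s1 where s1: "s1 \<le> num_nodes t * K"
    "call SOLVE [enc_g, enc_nats X, enc_decomp t] = Some (enc_table g (solve g X t), s1)"
    using Cons.prems[of t] by (auto elim: returnsE)
  obtain s2 where s2: "s2 \<le> sum_list (map num_nodes ts) * K + 20 * length ts + 20"
    "call SOLVES [enc_g, enc_nats X, enc_list (map enc_decomp ts)] =
       Some (enc_list (map (enc_table g) (map (solve g X) ts)), s2)"
    using Cons by (auto elim: returnsE)
  show ?case unfolding returns_def call_unfold using s1 s2 by (simp add: algebra_simps)
qed

lemma returns_SOLVE:
  assumes "bags_le W T" and "W \<le> L" and "num_nodes T \<le> L" and "length X \<le> L"
  shows "returns SOLVE [enc_g, enc_nats X, enc_decomp T] (enc_table g (solve g X T))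
    (num_nodes T * (4000 * L ^ 3 * D ^ W))"
  using assms(1,3,4)
proof (induction T arbitrary: X)
  case (Bag Y ts)
  let ?ys = "sorted_list_of_set Y"
  let ?A = "filter (\<lambda>v. v \<in> set X) ?ys" and ?B = "filter (\<lambda>v. v \<notin> set X) ?ys"
  let ?K = "4000 * L ^ 3 * D ^ W"
  have Y: "finite Y" "card Y \<le> W" "card Y \<le> L" using Bag.prems assms(2) by auto
  \<comment> \<open>The exponent arises here: every vertex of the bag is branched upon once, either
    as part of the key or when it is forgotten.\<close>
  have AB: "length ?A + length ?B = card Y"
    using sum_length_filter_compl[of "\<lambda>v. v \<in> set X" ?ys] Y(1) by simp
  have nodes: "sum_list (map num_nodes ts) \<le> L" using Bag.prems by simp
  have child: "returns SOLVE [enc_g, enc_nats ?ys, enc_decomp t] (enc_table g (solve g ?ys t))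
      (num_nodes t * ?K)" if "t \<in> set ts" for t
    using Bag that num_nodes_le[OF that] nodes Y by auto
  obtain s1 where s1: "s1 \<le> sum_list (map num_nodes ts) * ?K + 20 * length ts + 20"
    "call SOLVES [enc_g, enc_nats ?ys, enc_list (map enc_decomp ts)] =
       Some (enc_list (map (enc_table g) (map (solve g ?ys) ts)), s1)"
    using returns_SOLVES[OF child] by (rule returnsE)
  have filter_cost: "100 * (length X + 1) * (length ?ys + 1) \<le> 400 * L\<^sup>2"
  proof -
    have "100 * (length X + 1) * (length ?ys + 1) \<le> 100 * (L + L) * (L + L)"
      using Bag.prems Y L_pos by (intro mult_mono) auto
    also have "\<dots> = 400 * L\<^sup>2" by (simp add: power2_eq_square)
    finally show ?thesis .
  qed
  obtain s2 where s2: "s2 \<le> 400 * L\<^sup>2"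
    "call FILTER [Num 1, enc_nats ?ys, enc_nats X] = Some (enc_nats ?A, s2)"
    using returns_mono[OF returns_FILTER filter_cost, of 1] by (auto elim: returnsE)
  obtain s3 where s3: "s3 \<le> 400 * L\<^sup>2"
    "call FILTER [Num 0, enc_nats ?ys, enc_nats X] = Some (enc_nats ?B, s3)"
    using returns_mono[OF returns_FILTER filter_cost, of 0] by (auto elim: returnsE)
  have "length (snd (snd (solve g ?ys t) h)) \<le> L\<^sup>2" if "t \<in> set ts" for t h
  proof -
    have "num_nodes t * W \<le> L * L"
      using num_nodes_le[OF that] nodes assms(2) by (intro mult_mono) auto
    then show ?thesis
      using length_solve[of W t g ?ys h] Bag.prems that by (simp add: power2_eq_square)
  qed
  moreover have "length (fst (solve g ?ys t)) \<le> L" if "t \<in> set ts" for t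
    using length_fst_solve[of W t ?ys] Bag.prems that assms(2) by auto
  moreover have ts: "length ts \<le> L" using length_le_num_nodes[of ts] nodes by simp
  ultimately have small: "small_tables (map (solve g ?ys) ts)"
    by (auto simp: small_tables_def) (metis fst_conv, metis snd_conv)
  let ?F = "forget g (\<lambda>f. gather f (map (solve g ?ys) ts)) ?B"
  let ?T = "D ^ (length ?A + length ?B) * (1200 * L ^ 3 + (length ?A + length ?B) * (1000 * L\<^sup>2))"
  obtain s4 where s4: "s4 \<le> ?T"
    "call TABLE [enc_g, enc_nats ?A, enc_nats ?B, Num 0, enc_list (map (enc_table g) (map (solve g ?ys) ts))] =
       Some (enc_tab g ?F ?A [], s4)"
    using returns_TABLE[OF small admissible_Nil, of ?A ?B] Y AB by (auto elim: returnsE)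
  have "?T \<le> D ^ W * (1200 * L ^ 3 + L * (1000 * L\<^sup>2))"
    unfolding AB using Y D_pos L_pos by (intro mult_mono add_mono power_increasing) auto
  also have "\<dots> = 2200 * L ^ 3 * D ^ W" by (simp add: power2_eq_square power3_eq_cube)
  finally have s4': "s4 \<le> 2200 * L ^ 3 * D ^ W" using s4(1) by linarith
  have pow: "L ^ 3 \<le> L ^ 3 * D ^ W" using D_pos by simp
  \<comment> \<open>Both filters and the trie need at most 800 + 2200 of the 4000; traversing the
    children and the constant steps fit into the rest.\<close>
  have "s1 + s2 + s3 + s4 + 100 \<le> sum_list (map num_nodes ts) * ?K + 4000 * L ^ 3 * D ^ W"
    using s1(1) s2(1) s3(1) s4' ts powers_L pow by linarith
  then show ?case unfolding returns_def call_unfold using s1(2) s2(2) s3(2) s4(2)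
    by (simp add: Let_def enc_table_def enc_set_def)
qed

lemma run_main:
  assumes "bags_le W T" and "W \<le> L" and "num_nodes T \<le> L"
  shows "\<exists>s. computes dp_prog (Cell enc_g (enc_decomp T))
    (enc_map Num (map (\<lambda>(v, a). (v, val_of (snd (snd (solve g [] T) [])) v)) g)) s \<and>
    s \<le> 5000 * L ^ 4 * D ^ W"
proof -
  let ?sol = "snd (snd (solve g [] T) [])"
  obtain s1 where s1: "s1 \<le> num_nodes T * (4000 * L ^ 3 * D ^ W)"
    "call SOLVE [enc_g, Num 0, enc_decomp T] = Some (enc_table g (solve g [] T), s1)"
    using returns_SOLVE[OF assms, of "[]"] by (auto elim: returnsE)
  obtain s2 where s2: "s2 \<le> 40 * (length ?sol + 1) * (length g + 1)"
    "call OUTPUT [enc_g, enc_map Num ?sol] =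
       Some (enc_map Num (map (\<lambda>(v, a). (v, val_of ?sol v)) g), s2)"
    using returns_OUTPUT by (rule returnsE)
  have L4: "L ^ 4 = L * L ^ 3" by (simp add: eval_nat_numeral)
  have "num_nodes T * W \<le> L * L"
    using assms by (intro mult_mono) auto
  then have "length ?sol \<le> L * L"
    using length_solve[OF assms(1)] by (metis order_trans)
  then have "length ?sol + 1 \<le> L\<^sup>2 + L\<^sup>2"
    using powers_L(1) unfolding power2_eq_square by linarith
  then have "40 * (length ?sol + 1) * (length g + 1) \<le> 40 * (L\<^sup>2 + L\<^sup>2) * (L + L)"
    using length_graph L_pos by (intro mult_mono) auto
  also have "\<dots> = 160 * L ^ 3" by (simp add: power2_eq_square power3_eq_cube)
  also have "\<dots> \<le> 160 * L ^ 4 * D ^ W"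
    using mult_mono[of "L ^ 3" "L ^ 4" 1 "D ^ W"] L_pos D_pos by (simp add: power_increasing)
  finally have s2': "s2 \<le> 160 * L ^ 4 * D ^ W" using s2(1) by linarith
  have "num_nodes T * (4000 * L ^ 3 * D ^ W) \<le> L * (4000 * L ^ 3 * D ^ W)"
    using assms(3) by (rule mult_right_mono) simp
  also have "\<dots> = 4000 * L ^ 4 * D ^ W" unfolding L4 by (simp only: ac_simps)
  finally have s1': "s1 \<le> 4000 * L ^ 4 * D ^ W" using s1(1) by linarith
  have "1 \<le> L ^ 4 * D ^ W" using L_pos D_pos by simp
  then have total: "s1 + s2 + 100 \<le> 5000 * L ^ 4 * D ^ W" using s1' s2' by linarith
  \<comment> \<open>There is no bag above the root, so its key is empty and its trie is a single
    result; the two \<open>Snd\<close> in \<open>main_body\<close> therefore reach the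
    assignment.\<close>
  have "fst (solve g [] T) = []" by (cases T) (simp add: Let_def)
  then have enc: "enc_table g (solve g [] T) = Cell (Num 0) (enc_result (snd (solve g [] T) []))"
    by (simp add: enc_table_def)
  obtain s where s: "s \<le> s1 + s2 + 100" "run dp_prog [Cell enc_g (enc_decomp T)] main_body =
      Some (enc_map Num (map (\<lambda>(v, a). (v, val_of ?sol v)) g), s)"
    unfolding main_body_def using s1(2) s2(2) by (simp add: enc enc_result_def)
  have "computes dp_prog (Cell enc_g (enc_decomp T))
      (enc_map Num (map (\<lambda>(v, a). (v, val_of ?sol v)) g)) s"
    using s(2) by (simp add: computes_def run_eq_Some_iff dp_prog_def)
  with total s(1) show ?thesis by (meson order_trans)
qed

end

section \<open>Correctness\<close>

fun verts_of :: "decomp \<Rightarrow> nat set" where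
  "verts_of (Bag Y ts) = Y \<union> (\<Union>t\<in>set ts. verts_of t)"

text \<open>
  \<open>nested X T\<close> expresses the connectivity condition for a subtree \<open>T\<close> hanging below the bag \<open>X\<close>.
\<close>

fun nested :: "nat set \<Rightarrow> decomp \<Rightarrow> bool" where
  "nested X (Bag Y ts) \<longleftrightarrow>
     finite Y \<and> (\<Union>t\<in>set ts. verts_of t) \<inter> X \<subseteq> Y \<and>
     sorted_wrt (\<lambda>t t'. verts_of t \<inter> verts_of t' \<subseteq> Y) ts \<and> (\<forall>t\<in>set ts. nested Y t)"

fun in_common_bag :: "nat \<Rightarrow> nat \<Rightarrow> decomp \<Rightarrow> bool" where
  "in_common_bag u v (Bag Y ts) \<longleftrightarrow> u \<in> Y \<and> v \<in> Y \<or> (\<exists>t\<in>set ts. in_common_bag u v t)"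

lemma in_common_bag_verts_of: "in_common_bag u v T \<Longrightarrow> u \<in> verts_of T \<and> v \<in> verts_of T"
  by (induction T) auto

lemma look_append: "look d (s @ f) v = (if v \<in> fst ` set s then look d s v else look d f v)"
  by (cases "map_of s v") (auto simp: look_def map_of_eq_None_iff[THEN iffD1] dest: map_of_SomeD
    intro: rev_image_eqI split: option.splits)

lemma look_rev_map: "look d (rev (map (\<lambda>v. (v, f v)) xs)) k = (if k \<in> set xs then f k else d)"
  unfolding rev_map look_map by simp

text \<open>Weight 0 stands for a missing edge, which is unambiguous as weights are positive.
  Constraints on non-adjacent pairs then hold trivially, and no separate edge relation is carried
  along.\<close>

locale weighted_graph =
  fixes g :: graph
  assumes wt_sym: "wt g u v = 0 \<longleftrightarrow> wt g v u = 0"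
    and wt_loop: "wt g v v = 0"
begin

section \<open>Optimal completions of a partial assignment\<close>

definition sat :: "(nat \<Rightarrow> nat) \<Rightarrow> nat \<Rightarrow> nat \<Rightarrow> bool" where
  "sat p u v \<longleftrightarrow> wt g u v \<le> p u \<or> wt g v u \<le> p v"

lemma sat_commute: "sat p u v \<longleftrightarrow> sat p v u"
  by (auto simp: sat_def)

lemma sat_no_edge: "wt g u v = 0 \<Longrightarrow> sat p u v"
  by (simp add: sat_def)

lemma sat_cong: "p u = q u \<Longrightarrow> p v = q v \<Longrightarrow> sat p u v \<longleftrightarrow> sat q u v"
  by (simp add: sat_def)

text \<open>
  The vertices in \<open>K\<close> are assigned by \<open>f\<close>, the assignment to those in \<open>R\<close> is sought. Edges within
  \<open>K\<close> are ignored, as they are treated higher up in the tree.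
\<close>

definition completes :: "nat set \<Rightarrow> nat set \<Rightarrow> assignment \<Rightarrow> nat \<times> assignment \<Rightarrow> bool" where
  "completes R K f r \<longleftrightarrow>
     distinct (map fst (snd r)) \<and> fst ` set (snd r) = R \<and> fst r = sum_list (map snd (snd r)) \<and>
     (\<forall>u\<in>R. \<forall>v\<in>R \<union> K. sat (val_of (snd r @ f)) u v)"

text \<open>Competitors may be limited to candidate values, because \<open>feasible_rounding\<close>
  brings every real solution into this form without increasing any value.\<close>

definition candidate :: "nat set \<Rightarrow> nat set \<Rightarrow> assignment \<Rightarrow> (nat \<Rightarrow> nat) \<Rightarrow> bool" where
  "candidate R K f q \<longleftrightarrow>
     (\<forall>v. q v \<in> set (cands g v)) \<and> (\<forall>v\<in>K. q v = val_of f v) \<and> (\<forall>u\<in>R. \<forall>v\<in>R \<union> K. sat q u v)"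

definition best :: "nat set \<Rightarrow> nat set \<Rightarrow> assignment \<Rightarrow> nat \<times> assignment \<Rightarrow> bool" where
  "best R K f r \<longleftrightarrow> completes R K f r \<and> (\<forall>q. candidate R K f q \<longrightarrow> fst r \<le> sum q R)"

text \<open>Both halves of the correctness of raising follow: the raised value satisfies the edges
  to all assigned vertices, and a value that already satisfies them stays as it is.\<close>

lemma lower_le_iff:
  "lower g v f \<le> b \<longleftrightarrow> (\<forall>(u, a)\<in>set f. wt g u v \<le> a \<or> wt g v u \<le> b)"
  by (induction g v f rule: lower.induct) auto

lemma lower_le_iff_distinct:
  assumes "distinct (map fst f)"
  shows "lower g v f \<le> b \<longleftrightarrow> (\<forall>u\<in>fst ` set f. wt g u v \<le> val_of f u \<or> wt g v u \<le> b)"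
proof -
  have "val_of f u = a" if "(u, a) \<in> set f" for u a
    using map_of_is_SomeI[OF assms that] by (simp add: look_def)
  then show ?thesis unfolding lower_le_iff by force
qed

text \<open>When \<open>v\<close> moves from the assigned to the sought vertices, only its edges to
  \<open>K\<close> become new obligations, and \<open>b\<close> meets them by the bound
  \<open>lower\<close>. Edges between \<open>v\<close> and \<open>R\<close> were already required of
  \<open>r\<close>.\<close>

lemma completes_forget:
  assumes f: "distinct (map fst f)" "fst ` set f = K" and v: "v \<notin> K" "v \<notin> R" and "R \<inter> K = {}"
    and b: "lower g v f \<le> b" and r: "completes R (insert v K) ((v, b) # f) r"
  shows "completes (insert v R) K f (b + fst r, (v, b) # snd r)"
proof -
  have s: "fst ` set (snd r) = R" using r by (simp add: completes_def)
  let ?p = "val_of (((v, b) # snd r) @ f)"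
  have p: "?p = val_of (snd r @ (v, b) # f)"
    using v(2) s by (auto simp: look_append fun_eq_iff)
  have sat: "sat ?p u w" if "u \<in> R" "w \<in> insert v (R \<union> K)" for u w
    using r that unfolding p completes_def by auto
  have satv: "sat ?p v w" if "w \<in> insert v (R \<union> K)" for w
  proof (cases "w \<in> R")
    case True
    then show ?thesis using sat[of w v] sat_commute by blast
  next
    case False
    show ?thesis
    proof (cases "w = v")
      case True
      then show ?thesis by (simp add: sat_no_edge wt_loop)
    next
      case neq: False
      with that False have "w \<in> K" by auto
      with b f have "wt g w v \<le> val_of f w \<or> wt g v w \<le> b"
        using lower_le_iff_distinct by auto
      moreover have "?p w = val_of f w" "?p v = b"
        using neq False s by (auto simp: look_append)
      ultimately show ?thesis unfolding sat_def by metis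
    qed
  qed
  show ?thesis
    using r s v(2) sat satv unfolding completes_def by auto
qed

lemma best_forget:
  assumes h: "\<And>f. distinct (map fst f) \<Longrightarrow> fst ` set f = Y \<Longrightarrow> best R Y f (h f)"
    and "R \<inter> Y = {}"
    and "distinct (map fst f)" "distinct B" "fst ` set f \<inter> set B = {}" "fst ` set f \<union> set B = Y"
  shows "best (R \<union> set B) (fst ` set f) f (forget g h B f)"
  using assms(3-)
proof (induction B arbitrary: f)
  case Nil
  then show ?case using h by simp
next
  case (Cons v B)
  let ?K = "fst ` set f" and ?R = "R \<union> set B"
  let ?b = "\<lambda>a. max (lower g v f) a"
  let ?r = "\<lambda>a. forget g h B ((v, ?b a) # f)"
  let ?r' = "\<lambda>a. (?b a + fst (?r a), (v, ?b a) # snd (?r a))"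
  let ?rs = "map ?r' (cands g v)"
  have v: "v \<notin> ?K" "v \<notin> ?R" "?R \<inter> ?K = {}" using Cons.prems assms(2) by auto
  have IH: "best ?R (insert v ?K) ((v, ?b a) # f) (?r a)" for a
    using Cons.IH[of "(v, ?b a) # f"] Cons.prems v by auto
  have completes: "completes (insert v ?R) ?K f (?r' a)" for a
    using completes_forget[OF Cons.prems(1) refl v, of "?b a" "?r a"] IH unfolding best_def by auto
  have opt: "\<exists>r\<in>set ?rs. fst r \<le> sum q (insert v ?R)" if q: "candidate (insert v ?R) ?K f q" for q
  proof -
    \<comment> \<open>The competitor \<open>q\<close> is compared with the branch
      \<open>a = q v\<close>. As \<open>q\<close> satisfies the edges between \<open>v\<close> and
      \<open>?K\<close>, raising does not alter this value.\<close>
    have "lower g v f \<le> q v"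
      unfolding lower_le_iff_distinct[OF Cons.prems(1)]
    proof
      fix u assume u: "u \<in> ?K"
      with q have "sat q v u" "q u = val_of f u" unfolding candidate_def by auto
      then show "wt g u v \<le> val_of f u \<or> wt g v u \<le> q v" unfolding sat_def by auto
    qed
    then have b: "?b (q v) = q v" by simp
    have "candidate ?R (insert v ?K) ((v, q v) # f) q"
      using q v(1) unfolding candidate_def by auto
    with IH[of "q v"] have "fst (?r (q v)) \<le> sum q ?R" unfolding best_def b by blast
    moreover have "finite ?R"
      using IH[of 0] unfolding best_def completes_def by (metis List.finite_set finite_imageI)
    ultimately have "fst (?r' (q v)) \<le> sum q (insert v ?R)" using v(2) b by simp
    moreover have "q v \<in> set (cands g v)" using q by (simp add: candidate_def)
    ultimately show ?thesis by force
  qed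
  have ne: "?rs \<noteq> []" using cands_not_Nil by simp
  let ?m = "arg_min_list fst ?rs"
  have "?m \<in> set ?rs" using arg_min_list_in[OF ne] .
  then have "completes (insert v ?R) ?K f ?m" using completes by auto
  moreover have "fst ?m \<le> fst r" if "r \<in> set ?rs" for r
    using that f_arg_min_list_f[OF ne, of fst] by simp
  ultimately have "best (insert v ?R) ?K f ?m"
    using opt unfolding best_def by (meson order_trans)
  then show ?case by (simp add: Let_def)
qed

text \<open>The optima of the children add up because the sets \<open>R t\<close> are disjoint and,
  by the last assumption, an edge leaving \<open>R t\<close> ends in the key of \<open>t\<close>:
  neither other children nor the rest of \<open>Y\<close> constrain the values on
  \<open>R t\<close>.\<close>

lemma best_gather:
  assumes "sorted_wrt (\<lambda>t t'. R t \<inter> R t' = {}) ts"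
    and "\<And>t. t \<in> set ts \<Longrightarrow> set (fst (S t)) \<subseteq> Y \<and> R t \<inter> Y = {}"
    and "\<And>t. t \<in> set ts \<Longrightarrow> distinct (fst (S t))"
    and "\<And>t f. t \<in> set ts \<Longrightarrow> distinct (map fst f) \<Longrightarrow> fst ` set f = set (fst (S t)) \<Longrightarrow>
      best (R t) (set (fst (S t))) f (snd (S t) f)"
    and "\<And>t u v. t \<in> set ts \<Longrightarrow> u \<in> R t \<Longrightarrow> wt g u v \<noteq> 0 \<Longrightarrow> v \<in> R t \<union> set (fst (S t))"
  shows "best (\<Union>t\<in>set ts. R t) Y f (gather f (map S ts))"
  using assms
proof (induction ts)
  case Nil
  then show ?case by (simp add: best_def completes_def)
next
  case (Cons t ts)
  obtain A F where S: "S t = (A, F)" by force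
  let ?R' = "\<Union>t\<in>set ts. R t" and ?q = "gather f (map S ts)"
  let ?fA = "rev (map (\<lambda>v. (v, val_of f v)) A)"
  let ?r = "F ?fA"
  have IH: "best ?R' Y f ?q" using Cons.prems by (intro Cons.IH) auto
  have A: "set A \<subseteq> Y" "R t \<inter> Y = {}" "distinct A"
    using Cons.prems(2)[of t] Cons.prems(3)[of t] S by auto
  have keys: "fst ` set ?fA = set A" by force
  moreover have "distinct (map fst ?fA)" using A(3) by (simp add: rev_map[symmetric] comp_def)
  ultimately have r: "best (R t) (set A) ?fA ?r" using Cons.prems(4)[of t ?fA] S by simp
  have disj: "R t \<inter> ?R' = {}" using Cons.prems(1) by auto
  have disj': "?R' \<inter> Y = {}" using Cons.prems(2) by auto
  have edge: "v \<in> R t \<union> set A" if "u \<in> R t" "wt g u v \<noteq> 0" for u v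
    using Cons.prems(5)[of t u v] that S by simp
  have sr: "fst ` set (snd ?r) = R t" and sq: "fst ` set (snd ?q) = ?R'"
    using r IH by (auto simp: best_def completes_def)
  let ?p = "val_of ((snd ?r @ snd ?q) @ f)"
  \<comment> \<open>The entry of \<open>t\<close> was computed for \<open>?fA\<close>, the
    restriction of \<open>f\<close> to the key. Combining changes nothing on \<open>R t\<close> and
    the key, since the children assign no vertex of \<open>Y\<close>.\<close>
  have p1: "?p v = val_of (snd ?r @ ?fA) v" if "v \<in> R t \<union> set A" for v
    using that A disj disj' by (auto simp: look_append look_rev_map sr sq)
  have p2: "?p v = val_of (snd ?q @ f) v" if "v \<notin> R t" for v
    using that by (simp add: look_append sr)
  have sat1: "sat ?p u v" if u: "u \<in> R t" for u v
  proof (cases "wt g u v = 0")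
    case False
    then have v: "v \<in> R t \<union> set A" using edge u by blast
    with r u have "sat (val_of (snd ?r @ ?fA)) u v" by (auto simp: best_def completes_def)
    then show ?thesis using p1[of u] p1[of v] u v sat_cong by blast
  qed (rule sat_no_edge)
  have sat2: "sat ?p u v" if u: "u \<in> ?R'" and v: "v \<in> R t \<union> ?R' \<union> Y" for u v
  proof (cases "v \<in> R t")
    case True
    then show ?thesis using sat1 sat_commute by blast
  next
    case False
    have "\<forall>u\<in>?R'. \<forall>v\<in>?R' \<union> Y. sat (val_of (snd ?q @ f)) u v"
      using IH unfolding best_def completes_def by (elim conjE)
    with u v False have "sat (val_of (snd ?q @ f)) u v" by blast
    moreover have "u \<notin> R t" using u disj by auto
    ultimately show ?thesis using p2[of u] p2[of v] False sat_cong by blast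
  qed
  have "completes (R t \<union> ?R') Y f (fst ?r + fst ?q, snd ?r @ snd ?q)"
    unfolding completes_def fst_conv snd_conv
  proof (intro conjI)
    show "distinct (map fst (snd ?r @ snd ?q))"
      using r IH disj by (simp add: best_def completes_def sr sq)
    show "fst ` set (snd ?r @ snd ?q) = R t \<union> ?R'" by (simp add: image_Un sr sq)
    show "fst ?r + fst ?q = sum_list (map snd (snd ?r @ snd ?q))"
      using r IH by (simp add: best_def completes_def)
    show "\<forall>u\<in>R t \<union> ?R'. \<forall>v\<in>R t \<union> ?R' \<union> Y. sat ?p u v" using sat1 sat2 by blast
  qed
  then have "completes (R t \<union> ?R') Y f (gather f (map S (t # ts)))" by (simp add: S Let_def)
  moreover have "fst (gather f (map S (t # ts))) \<le> sum q (R t \<union> ?R')"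
    if q: "candidate (R t \<union> ?R') Y f q" for q
  proof -
    have "candidate (R t) (set A) ?fA q"
      using q A unfolding candidate_def by (auto simp: look_rev_map)
    moreover have "candidate ?R' Y f q" using q unfolding candidate_def by auto
    ultimately have "fst ?r + fst ?q \<le> sum q (R t) + sum q ?R'"
      using r IH unfolding best_def by (simp add: add_mono)
    moreover have "finite (R t)" "finite ?R'" using sr sq by (metis List.finite_set finite_imageI)+
    ultimately show ?thesis using disj by (simp add: S Let_def sum.union_disjoint)
  qed
  ultimately show ?case by (simp add: best_def)
qed

theorem best_solve:
  assumes "nested (set X) T"
    and "\<And>u v. u \<in> verts_of T - set X \<Longrightarrow> wt g u v \<noteq> 0 \<Longrightarrow> in_common_bag u v T"
    and "distinct (map fst f)" "fst ` set f = set (fst (solve g X T))"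
  shows "best (verts_of T - set X) (set (fst (solve g X T))) f (snd (solve g X T) f)"
  using assms
proof (induction T arbitrary: X f)
  case (Bag Y ts)
  let ?ys = "sorted_list_of_set Y"
  have Y: "finite Y" "set ?ys = Y" using Bag.prems(1) by auto
  have fst_solve: "set (fst (solve g ?ys t)) \<subseteq> Y" "distinct (fst (solve g ?ys t))" for t
    unfolding atomize_conj by (cases t) (auto simp: Let_def Y)
  \<comment> \<open>By \<open>nested\<close>, a vertex of the subtree that lies in \<open>Y\<close>
    also lies in the root bag of \<open>t\<close>, hence in the key.\<close>
  have V: "verts_of t \<inter> Y \<subseteq> set (fst (solve g ?ys t))" if t: "t \<in> set ts" for t
  proof (cases t)
    case (Bag Z us)
    moreover have "nested Y t" using Bag.prems(1) t by auto
    ultimately show ?thesis by (auto simp: Let_def Y)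
  qed
  \<comment> \<open>Being outside \<open>Y\<close>, the vertex \<open>u\<close> occurs below one
    child only, so the bag it shares with \<open>v\<close> must be there.\<close>
  have child: "in_common_bag u v t" if t: "t \<in> set ts" "u \<in> verts_of t - Y" "wt g u v \<noteq> 0" for t u v
  proof -
    have "u \<in> verts_of (Bag Y ts) - set X" using t Bag.prems(1) by auto
    then have "in_common_bag u v (Bag Y ts)" using Bag.prems(2) t(3) by blast
    then obtain t' where t': "t' \<in> set ts" "in_common_bag u v t'" using t(2) by auto
    have "t' = t"
    proof (rule ccontr)
      assume "t' \<noteq> t"
      moreover have "sorted_wrt (\<lambda>t t'. verts_of t \<inter> verts_of t' \<subseteq> Y) ts" using Bag.prems(1) by simp
      ultimately have "verts_of t \<inter> verts_of t' \<subseteq> Y"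
        using t(1) t'(1) by (induction ts) auto
      then show False using in_common_bag_verts_of[OF t'(2)] t(2) by auto
    qed
    with t' show ?thesis by simp
  qed
  have gather: "best (\<Union>t\<in>set ts. verts_of t - Y) Y f (gather f (map (solve g ?ys) ts))" for f
  proof (rule best_gather)
    show "sorted_wrt (\<lambda>t t'. (verts_of t - Y) \<inter> (verts_of t' - Y) = {}) ts"
      using Bag.prems(1) by (auto elim!: sorted_wrt_mono_rel[rotated])
    show "set (fst (solve g ?ys t)) \<subseteq> Y \<and> (verts_of t - Y) \<inter> Y = {}" for t
      using fst_solve by auto
    show "distinct (fst (solve g ?ys t))" for t by (rule fst_solve)
    show "best (verts_of t - Y) (set (fst (solve g ?ys t))) f (snd (solve g ?ys t) f)"
      if "t \<in> set ts" "distinct (map fst f)" "fst ` set f = set (fst (solve g ?ys t))" for t f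
      using Bag.IH[OF that(1) _ _ that(2,3)] Bag.prems(1) child[OF that(1)] that(1) unfolding Y(2) by simp
    show "v \<in> verts_of t - Y \<union> set (fst (solve g ?ys t))"
      if "t \<in> set ts" "u \<in> verts_of t - Y" "wt g u v \<noteq> 0" for t u v
      using in_common_bag_verts_of[OF child[OF that]] V[OF that(1)] by auto
  qed
  let ?B = "filter (\<lambda>v. v \<notin> set X) ?ys"
  have f: "fst ` set f = Y \<inter> set X" using Bag.prems(4) Y by (auto simp: Let_def)
  have "best ((\<Union>t\<in>set ts. verts_of t - Y) \<union> set ?B) (fst ` set f) f
      (forget g (\<lambda>f. gather f (map (solve g ?ys) ts)) ?B f)"
  proof (rule best_forget[OF gather])
    show "distinct ?B" using Y by simp
  qed (use f Bag.prems(3) Y in auto)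
  moreover have "(\<Union>t\<in>set ts. verts_of t - Y) \<union> set ?B = verts_of (Bag Y ts) - set X"
    using Bag.prems(1) Y by auto
  ultimately show ?case using f Y by (simp add: Let_def Int_def)
qed

end

section \<open>Tree decompositions\<close>

lemma verts_of_eq: "verts_of T = (\<Union>x\<in>nodes T. bag T x)"
proof (induction T)
  case (Bag Y ts)
  have "(\<Union>t\<in>set ts. verts_of t) = (\<Union>i<length ts. verts_of (ts ! i))"
    by (auto simp: set_conv_nth)
  also have "\<dots> = (\<Union>i<length ts. \<Union>x\<in>nodes (ts ! i). bag (ts ! i) x)"
    using Bag by simp
  finally show ?case by auto
qed

lemma Nil_in_nodes: "[] \<in> nodes T"
  by (cases T) simp

lemma finite_nodes: "finite (nodes T)"
  by (induction T) auto

lemma card_nodes: "card (nodes T) = num_nodes T"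
proof (induction T)
  case (Bag Y ts)
  have "card (\<Union>i<length ts. (#) i ` nodes (ts ! i)) = (\<Sum>i<length ts. card ((#) i ` nodes (ts ! i)))"
    by (rule card_UN_disjoint) (auto simp: finite_nodes)
  also have "\<dots> = (\<Sum>i<length ts. num_nodes (ts ! i))"
    using Bag by (simp add: card_image)
  also have "\<dots> = sum_list (map num_nodes ts)"
    by (simp add: sum_list_sum_nth atLeast0LessThan)
  finally show ?case
    by (simp, subst card_insert_disjoint) (auto simp: finite_nodes)
qed

lemma in_common_bagI: "x \<in> nodes T \<Longrightarrow> u \<in> bag T x \<Longrightarrow> v \<in> bag T x \<Longrightarrow> in_common_bag u v T"
proof (induction T arbitrary: x)
  case (Bag Y ts)
  then show ?case by (cases x) (auto dest: nth_mem)
qed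

lemma bags_leI: "(\<And>x. x \<in> nodes T \<Longrightarrow> finite (bag T x) \<and> card (bag T x) \<le> m) \<Longrightarrow> bags_le m T"
proof (induction T)
  case (Bag Y ts)
  have "bags_le m t" if t: "t \<in> set ts" for t
  proof -
    obtain i where "i < length ts" "ts ! i = t" using t by (auto simp: in_set_conv_nth)
    then have "finite (bag t x) \<and> card (bag t x) \<le> m" if "x \<in> nodes t" for x
      using Bag.prems[of "i # x"] that by auto
    then show ?thesis using Bag.IH[OF t] by blast
  qed
  then show ?case using Bag.prems[of "[]"] by auto
qed

text \<open>
  A vertex occurring both inside and outside the subtree at \<open>q @ [i]\<close> lies in both bags at the edge
  above this subtree.
\<close>

definition crossing :: "decomp \<Rightarrow> bool" where
  "crossing T \<longleftrightarrow>
     (\<forall>v q i x y. q @ i # x \<in> nodes T \<and> v \<in> bag T (q @ i # x) \<and> y \<in> nodes T \<and> v \<in> bag T y \<and>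
        \<not> prefix (q @ [i]) y \<longrightarrow> v \<in> bag T q \<and> v \<in> bag T (q @ [i]))"

lemma crossingD:
  "crossing T \<Longrightarrow> q @ i # x \<in> nodes T \<Longrightarrow> v \<in> bag T (q @ i # x) \<Longrightarrow> y \<in> nodes T \<Longrightarrow>
    v \<in> bag T y \<Longrightarrow> \<not> prefix (q @ [i]) y \<Longrightarrow> v \<in> bag T q \<and> v \<in> bag T (q @ [i])"
  unfolding crossing_def by blast

lemma crossing_subtree:
  assumes "crossing (Bag Y ts)" and "k < length ts"
  shows "crossing (ts ! k)"
  unfolding crossing_def
proof (intro allI impI)
  fix v q i x y
  assume "q @ i # x \<in> nodes (ts ! k) \<and> v \<in> bag (ts ! k) (q @ i # x) \<and> y \<in> nodes (ts ! k) \<and>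
    v \<in> bag (ts ! k) y \<and> \<not> prefix (q @ [i]) y"
  then show "v \<in> bag (ts ! k) q \<and> v \<in> bag (ts ! k) (q @ [i])"
    using crossingD[OF assms(1), of "k # q" i x v "k # y"] assms(2) by auto
qed

lemma crossing_nested:
  assumes "crossing T" and "verts_of T \<inter> X \<subseteq> bag T []" and "bags_le m T"
  shows "nested X T"
  using assms
proof (induction T arbitrary: X)
  case (Bag Y ts)
  \<comment> \<open>This is \<open>crossing\<close> at an edge below the root. With
    \<open>y = []\<close> it makes each child nested in \<open>Y\<close>; with \<open>y\<close> in
    another subtree it gives the pairwise condition.\<close>
  have meet: "v \<in> Y \<and> v \<in> bag (ts ! k) []"
    if k: "k < length ts" and v: "v \<in> verts_of (ts ! k)" and y: "y \<in> nodes (Bag Y ts)" "v \<in> bag (Bag Y ts) y"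
      "\<not> prefix [k] y" for k v y
  proof -
    obtain x where x: "x \<in> nodes (ts ! k)" "v \<in> bag (ts ! k) x"
      using v by (auto simp: verts_of_eq)
    then have "[] @ k # x \<in> nodes (Bag Y ts)" using k by auto
    from crossingD[OF Bag.prems(1) this, of v y] show ?thesis using x k y by simp
  qed
  have "nested Y t" if t: "t \<in> set ts" for t
  proof -
    obtain k where k: "k < length ts" "t = ts ! k" using t by (auto simp: in_set_conv_nth)
    have "verts_of t \<inter> Y \<subseteq> bag t []" using meet[OF k(1), of _ "[]"] k by auto
    then show ?thesis
      using Bag.IH[OF t] crossing_subtree[OF Bag.prems(1) k(1)] Bag.prems(3) t k by auto
  qed
  moreover have "sorted_wrt (\<lambda>t t'. verts_of t \<inter> verts_of t' \<subseteq> Y) ts"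
    unfolding sorted_wrt_iff_nth_less
  proof (intro allI impI subsetI)
    fix k l v assume kl: "k < l" "l < length ts" "v \<in> verts_of (ts ! k) \<inter> verts_of (ts ! l)"
    then obtain y where "y \<in> nodes (ts ! l)" "v \<in> bag (ts ! l) y" by (auto simp: verts_of_eq)
    then show "v \<in> Y" using meet[of k v "l # y"] kl by auto
  qed
  moreover have "finite Y" using Bag.prems(3) by simp
  ultimately show ?case using Bag.prems(2) by auto
qed

text \<open>The edge from \<open>q\<close> to \<open>q @ [i]\<close> is the only one that leads out
  of the subtree, so a walk leaving it inside \<open>S\<close> passes through both ends.\<close>

lemma reachable_crossing:
  assumes "x \<rightarrow>\<^sup>*\<^bsub>mk_symmetric (decomp_tree T \<restriction> S)\<^esub> y"
    and "prefix (q @ [i]) x" and "\<not> prefix (q @ [i]) y"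
  shows "q \<in> S \<and> q @ [i] \<in> S"
  using reachable_rtranclI[OF assms(1)] assms(2,3)
proof (induction rule: rtrancl_induct)
  case (step y z)
  then show ?case
    by (cases "prefix (q @ [i]) y") (auto simp: parcs_mk_symmetric decomp_tree_def)
qed auto

context
  fixes G :: "nat pair_pre_digraph" and w :: "nat \<Rightarrow> nat \<Rightarrow> nat" and T :: decomp
  assumes dpvc: "dpvc G w" and T: "tree_decomposition G T"
begin

interpretation dpvc G w by (rule dpvc)

lemma decomposition_crossing: "crossing T"
  unfolding crossing_def
proof (intro allI impI)
  fix v q i x y
  let ?S = "{x \<in> nodes T. v \<in> bag T x}"
  let ?H = "mk_symmetric (decomp_tree T \<restriction> ?S)"
  assume *: "q @ i # x \<in> nodes T \<and> v \<in> bag T (q @ i # x) \<and> y \<in> nodes T \<and> v \<in> bag T y \<and>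
    \<not> prefix (q @ [i]) y"
  then have "v \<in> pverts G" using T by (auto simp: tree_decomposition_def)
  then have "strongly_connected ?H"
    using T by (auto simp: tree_decomposition_def connected_def)
  then have "(q @ i # x) \<rightarrow>\<^sup>*\<^bsub>?H\<^esub> y"
    using * by (auto simp: strongly_connected_def decomp_tree_def)
  from reachable_crossing[OF this, of q i] * show "v \<in> bag T q \<and> v \<in> bag T (q @ [i])"
    by auto
qed

lemma verts_of_decomposition: "verts_of T = pverts G"
proof
  show "verts_of T \<subseteq> pverts G" using T by (auto simp: verts_of_eq tree_decomposition_def)
  show "pverts G \<subseteq> verts_of T"
  proof
    fix v assume "v \<in> pverts G"
    then have "connected (decomp_tree T \<restriction> {x \<in> nodes T. v \<in> bag T x})"
      using T by (auto simp: tree_decomposition_def)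
    then show "v \<in> verts_of T"
      by (auto simp: connected_def strongly_connected_def decomp_tree_def verts_of_eq)
  qed
qed

lemma bags_le_width: "bags_le (width T + 1) T"
proof (rule bags_leI)
  fix x assume x: "x \<in> nodes T"
  then have "bag T x \<subseteq> pverts G" using T by (auto simp: tree_decomposition_def)
  then have "finite (bag T x)" using pair_finite_verts finite_subset by blast
  moreover have "card (bag T x) \<le> Max ((\<lambda>x. card (bag T x)) ` nodes T)"
    using x finite_nodes by (intro Max_ge) auto
  \<comment> \<open>If all bags are empty, the subtraction in \<open>width\<close> truncates and the
    inequality still holds.\<close>
  ultimately show "finite (bag T x) \<and> card (bag T x) \<le> width T + 1" by (simp add: width_def)
qed

lemma width_le: "width T \<le> card (pverts G)"
proof -
  have "card (bag T x) \<le> card (pverts G)" if "x \<in> nodes T" for x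
    using T that pair_finite_verts by (intro card_mono) (auto simp: tree_decomposition_def)
  then have "Max ((\<lambda>x. card (bag T x)) ` nodes T) \<le> card (pverts G)"
    using finite_nodes Nil_in_nodes by (subst Max_le_iff) auto
  then show ?thesis by (simp add: width_def)
qed

lemma decomposition_nested: "nested {} T"
  using crossing_nested[OF decomposition_crossing _ bags_le_width] by simp

lemma decomposition_in_common_bag: "(u, v) \<in> parcs G \<Longrightarrow> in_common_bag u v T"
  using T in_common_bagI by (auto simp: tree_decomposition_def)

end

section \<open>Instances\<close>

definition graph_of :: "nat pair_pre_digraph \<Rightarrow> (nat \<Rightarrow> nat \<Rightarrow> nat) \<Rightarrow> graph" where
  "graph_of G w =
     map (\<lambda>u. (u, map (\<lambda>v. (v, w u v)) (sorted_list_of_set {v. (u, v) \<in> parcs G})))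
       (sorted_list_of_set (pverts G))"

lemma enc_graph_eq: "enc_graph G w = enc_map (enc_map Num) (graph_of G w)"
  by (simp add: enc_graph_def enc_set_def enc_map_def graph_of_def comp_def)

lemma enc_solution_eq:
  "enc_solution G p = enc_map Num (map (\<lambda>(v, a). (v, p v)) (graph_of G w))"
  by (simp add: enc_solution_def enc_set_def enc_map_def graph_of_def comp_def)

context dpvc
begin

lemma finite_neighbours: "finite {v. (u, v) \<in> parcs G}"
proof (rule finite_subset)
  show "{v. (u, v) \<in> parcs G} \<subseteq> snd ` parcs G" by force
qed (use pair_finite_arcs in simp)

lemma look_graph_of:
  "look [] (graph_of G w) u = map (\<lambda>v. (v, w u v)) (sorted_list_of_set {v. (u, v) \<in> parcs G})"
proof (cases "u \<in> pverts G")
  case True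
  then show ?thesis using pair_finite_verts by (simp add: graph_of_def look_map)
next
  case False
  then have "{v. (u, v) \<in> parcs G} = {}" using in_arcsD1 by auto
  then show ?thesis using False pair_finite_verts by (simp add: graph_of_def look_map)
qed

lemma wt_graph_of: "wt (graph_of G w) u v = (if (u, v) \<in> parcs G then w u v else 0)"
  using finite_neighbours by (simp add: wt_def look_graph_of look_map)

lemma arc_sym: "(u, v) \<in> parcs G \<Longrightarrow> (v, u) \<in> parcs G"
  using pair_sym_arcs by (auto simp: symmetric_def dest: symD)

lemma wt_graph_of_eq_0_iff: "wt (graph_of G w) u v = 0 \<longleftrightarrow> (u, v) \<notin> parcs G"
  using weight_pos[of u v] by (auto simp: wt_graph_of)

sublocale weighted_graph "graph_of G w"
proof
  show "wt (graph_of G w) u v = 0 \<longleftrightarrow> wt (graph_of G w) v u = 0" for u v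
    using arc_sym wt_graph_of_eq_0_iff by blast
  show "wt (graph_of G w) v v = 0" for v
    using pair_no_loops[of "(v, v)"] by (auto simp: wt_graph_of_eq_0_iff)
qed

lemma set_cands_graph_of:
  "set (cands (graph_of G w) u) = insert 0 {w u v | v. (u, v) \<in> parcs G}"
  using finite_neighbours by (auto simp: set_cands look_graph_of image_image)

lemma length_adj_graph_of: "length (look [] (graph_of G w) u) = out_degree G u"
proof -
  have "out_arcs G u = Pair u ` {v. (u, v) \<in> parcs G}" by (auto simp: out_arcs_def)
  then show ?thesis
    using finite_neighbours by (simp add: look_graph_of out_degree_def card_image inj_on_def)
qed

lemma length_adj_le: "length (look [] (graph_of G w) u) \<le> card (pverts G)"
proof -
  have "{v. (u, v) \<in> parcs G} \<subseteq> pverts G" using in_arcsD2 by auto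
  then show ?thesis using pair_finite_verts by (simp add: look_graph_of card_mono)
qed

lemma length_cands_max_degree: "length (cands (graph_of G w) u) \<le> max_degree G + 1"
proof (cases "u \<in> pverts G")
  case True
  then have "out_degree G u \<le> max_degree G"
    unfolding max_degree_def using pair_finite_verts by (intro Max_ge) auto
  then show ?thesis using length_cands_le[of "graph_of G w" u] by (simp add: length_adj_graph_of)
next
  case False
  then have "{v. (u, v) \<in> parcs G} = {}" using in_arcsD1 by auto
  then show ?thesis using length_cands_le[of "graph_of G w" u] by (simp add: look_graph_of)
qed

lemma length_cands_max_weight: "length (cands (graph_of G w) u) \<le> max_weight G w + 1"
proof -
  have "w u v \<le> max_weight G w" if "(u, v) \<in> parcs G" for v
  proof -
    have "max (w u v) (w v u) \<le> max_weight G w"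
      unfolding max_weight_def using that pair_finite_arcs by (intro Max_ge) (auto intro: rev_image_eqI)
    then show ?thesis by simp
  qed
  then have "set (cands (graph_of G w) u) \<subseteq> {0..max_weight G w}" by (auto simp: set_cands_graph_of)
  then have "card (set (cands (graph_of G w) u)) \<le> card {0..max_weight G w}" by (intro card_mono) auto
  then show ?thesis by (simp add: distinct_card[OF distinct_cands])
qed

text \<open>Every value is rounded down to the largest candidate below it. If \<open>w u v\<close>
  is at most \<open>q u\<close>, it is one of the candidates considered, so a satisfied constraint
  survives.\<close>

lemma feasible_rounding:
  assumes "feasible G w q"
  obtains q' where "\<And>v. q' v \<in> set (cands (graph_of G w) v)" "\<And>u v. sat q' u v"
    "\<And>v. v \<in> pverts G \<Longrightarrow> real (q' v) \<le> q v"
proof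
  let ?C = "\<lambda>v. {a \<in> set (cands (graph_of G w) v). real a \<le> q v}"
  \<comment> \<open>Outside \<open>pverts G\<close> the solution \<open>q\<close> may be negative
    and \<open>?C\<close> empty; the inserted 0 provides a value there.\<close>
  let ?q = "\<lambda>v. Max (insert 0 (?C v))"
  have max: "?q v \<in> insert 0 (?C v)" for v by (rule Max_in) auto
  show "?q v \<in> set (cands (graph_of G w) v)" for v using max[of v] zero_in_cands by auto
  show "real (?q v) \<le> q v" if "v \<in> pverts G" for v
    using max[of v] that assms by (auto simp: feasible_def)
  have ge: "w u v \<le> ?q u" if "(u, v) \<in> parcs G" "real (w u v) \<le> q u" for u v
  proof (rule Max_ge)
    show "w u v \<in> insert 0 (?C u)" using that by (auto simp: set_cands_graph_of)
  qed simp
  show "sat ?q u v" for u v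
  proof (cases "(u, v) \<in> parcs G")
    case True
    then have "real (w u v) \<le> q u \<or> real (w v u) \<le> q v" using assms by (auto simp: feasible_def)
    then show ?thesis using ge[OF True] ge[OF arc_sym[OF True]] arc_sym[OF True] True
      by (auto simp: sat_def wt_graph_of)
  qed (simp add: sat_no_edge wt_graph_of)
qed

lemma optimal_solve:
  assumes "tree_decomposition G T"
  shows "optimal G w (\<lambda>v. real (val_of (snd (snd (solve (graph_of G w) [] T) [])) v))"
proof -
  let ?r = "snd (solve (graph_of G w) [] T) []"
  let ?s = "snd ?r"
  note T = dpvc_axioms assms
  have fst_solve: "fst (solve (graph_of G w) [] T) = []" by (cases T) (simp add: Let_def)
  have "best (verts_of T - set []) (set (fst (solve (graph_of G w) [] T))) [] ?r"
  proof (rule best_solve)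
    show "nested (set []) T" using decomposition_nested[OF T] by simp
    show "in_common_bag u v T" if "wt (graph_of G w) u v \<noteq> 0" for u v
      using decomposition_in_common_bag[OF T] that by (simp add: wt_graph_of_eq_0_iff)
  qed (simp_all add: fst_solve)
  \<comment> \<open>At the root nothing is assigned in advance, so the completion covers all
    vertices and every edge.\<close>
  then have best: "best (pverts G) {} [] ?r"
    by (simp add: fst_solve verts_of_decomposition[OF T])
  then have s: "distinct (map fst ?s)" "fst ` set ?s = pverts G" "fst ?r = sum_list (map snd ?s)"
    "\<And>u v. u \<in> pverts G \<Longrightarrow> v \<in> pverts G \<Longrightarrow> sat (val_of ?s) u v"
    by (auto simp: best_def completes_def)
  have "(\<Sum>v\<in>pverts G. val_of ?s v) = (\<Sum>x\<in>set ?s. val_of ?s (fst x))"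
    using s(1,2) sum.reindex[of fst "set ?s" "val_of ?s"] by (simp add: distinct_map)
  also have "\<dots> = (\<Sum>x\<in>set ?s. snd x)"
    using s(1) by (intro sum.cong) (auto simp: look_def)
  also have "\<dots> = fst ?r"
    using s(1,3) by (simp add: sum_list_distinct_conv_sum_set distinct_map)
  finally have cost: "(\<Sum>v\<in>pverts G. val_of ?s v) = fst ?r" .
  have "feasible G w (\<lambda>v. real (val_of ?s v))"
    unfolding feasible_def
  proof (intro conjI ballI, simp, clarify)
    fix u v assume uv: "(u, v) \<in> parcs G" "\<not> real (w v u) \<le> real (val_of ?s v)"
    have "sat (val_of ?s) u v" using uv(1) in_arcsD1 in_arcsD2 s(4) by blast
    then show "real (w u v) \<le> real (val_of ?s u)"
      using uv arc_sym[OF uv(1)] by (simp add: sat_def wt_graph_of)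
  qed
  moreover have "(\<Sum>v\<in>pverts G. real (val_of ?s v)) \<le> (\<Sum>v\<in>pverts G. q v)" if q: "feasible G w q" for q
  proof -
    obtain q' where q': "\<And>v. q' v \<in> set (cands (graph_of G w) v)" "\<And>u v. sat q' u v"
      "\<And>v. v \<in> pverts G \<Longrightarrow> real (q' v) \<le> q v"
      using feasible_rounding[OF q] by blast
    then have "candidate (pverts G) {} [] q'" by (simp add: candidate_def)
    with best have "fst ?r \<le> sum q' (pverts G)" by (simp add: best_def)
    then have "(\<Sum>v\<in>pverts G. real (val_of ?s v)) \<le> (\<Sum>v\<in>pverts G. real (q' v))"
      unfolding cost[symmetric] by (simp flip: of_nat_sum)
    also have "\<dots> \<le> (\<Sum>v\<in>pverts G. q v)" using q'(3) by (rule sum_mono)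
    finally show ?thesis .
  qed
  ultimately show ?thesis by (simp add: optimal_def)
qed

end

lemma solves_dpvc:
  assumes "\<And>G w v. dpvc G w \<Longrightarrow> length (cands (graph_of G w) v) \<le> D G w"
  shows "solves_dpvc_in_time dp_prog
    (\<lambda>G w T. 80000 * D G w ^ (width T + 1) * instance_size G T ^ 4)"
  unfolding solves_dpvc_in_time_def
proof (intro allI impI, elim conjE)
  fix G w T assume dpvc: "dpvc G w" and T: "tree_decomposition G T"
  interpret dpvc G w by (rule dpvc)
  let ?g = "graph_of G w" and ?N = "instance_size G T"
  let ?p = "val_of (snd (snd (solve ?g [] T) []))"
  have N: "card (pverts G) + num_nodes T = ?N" by (simp add: instance_size_def card_nodes)
  have "1 \<le> num_nodes T" by (cases T) simp
  then have N1: "1 \<le> ?N" using N by linarith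
  interpret bounded_graph ?g "?N + 1" "D G w"
  proof
    show "length ?g \<le> ?N + 1" using N by (simp add: graph_of_def)
    show "length (look [] ?g v) < ?N + 1" for v using length_adj_le[of v] N by linarith
    show "length (cands ?g v) \<le> D G w" for v using assms dpvc by blast
  qed
  obtain s where s: "computes dp_prog (Cell (enc_map (enc_map Num) ?g) (enc_decomp T))
      (enc_map Num (map (\<lambda>(v, a). (v, ?p v)) ?g)) s"
    "s \<le> 5000 * (?N + 1) ^ 4 * D G w ^ (width T + 1)"
    using run_main[OF bags_le_width[OF dpvc T]] width_le[OF dpvc T] N by auto
  \<comment> \<open>The root makes \<open>?N\<close> positive, so \<open>?N + 1\<close> is at most
    \<open>2 * ?N\<close>; this turns 5000 into \<open>5000 * 2 ^ 4 = 80000\<close>.\<close>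
  have "(?N + 1) ^ 4 \<le> (2 * ?N) ^ 4" using N1 by (intro power_mono) auto
  then have "5000 * (?N + 1) ^ 4 * D G w ^ (width T + 1) \<le> 5000 * (2 * ?N) ^ 4 * D G w ^ (width T + 1)"
    by (intro mult_right_mono mult_left_mono) auto
  also have "\<dots> = 80000 * D G w ^ (width T + 1) * ?N ^ 4"
    by (simp add: power_mult_distrib)
  finally have "s \<le> 80000 * D G w ^ (width T + 1) * ?N ^ 4"
    using s(2) by linarith
  with s(1) optimal_solve[OF T]
  show "\<exists>p s. computes dp_prog (enc_input G w T) (enc_solution G p) s \<and>
      optimal G w (\<lambda>v. real (p v)) \<and> s \<le> 80000 * D G w ^ (width T + 1) * ?N ^ 4"
    unfolding enc_input_def enc_graph_eq enc_solution_eq[of G _ w] by blast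
qed

theorem theorem4:
  shows "(\<exists>P c k. solves_dpvc_in_time P
            (\<lambda>G w T. c * (max_weight G w + 1) ^ (width T + 1) * instance_size G T ^ k)) \<and>
         (\<exists>P c k. solves_dpvc_in_time P
            (\<lambda>G w T. c * (max_degree G + 1) ^ (width T + 1) * instance_size G T ^ k))"
  using solves_dpvc[of "\<lambda>G w. max_weight G w + 1"] solves_dpvc[of "\<lambda>G w. max_degree G + 1"]
    dpvc.length_cands_max_weight dpvc.length_cands_max_degree by blast

end
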